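(* Let $(Q,\alpha)$ be a reduced quiver setting with at least $2$ vertices and let $R$ be a quiver that is a connected sum of cyclic quivers $\tilde A_i$ ($i\ge0$). Then $(R,\mathbf 1)$ is a local quiver setting of $(Q,\alpha)$ if and only if $Q$ looks the same as $R$ with every vertex replaced by a simple subquiver, the $\tilde A_i$-arrows starting and ending in vertices of dimension $1$; that is, if and only if there is a partition $Q_0=\bigsqcup_{u\in R_0}V_u$ into nonempty subsets such that \begin{itemize} \item for every $u\in R_0$, the full subquiver $Q_u$ of $Q$ on $V_u$ with dimension vector $\alpha|_{V_u}$ has simple representations, and the number of loops of $R$ at $u$ equals $1-\chi_{Q_u}(\alpha|_{V_u},\alpha|_{V_u})$; \item for all $u\ne w$ in $R_0$, the number of arrows of $Q$ from vertices in $V_u$ to vertices in $V_w$ equals the number of arrows of $R$ from $u$ to $w$, and every such arrow of $Q$ starts and ends in a vertex of dimension $1$. \end{itemize}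
   Context: $\mathbb{C}$ denotes an algebraically closed field of characteristic zero. A quiver $Q=(Q_0,Q_1,h,t)$ has finite sets of vertices and arrows; an arrow $a$ goes from $t(a)$ to $h(a)$. A quiver setting $(Q,\alpha)$ is a quiver with a dimension vector $\alpha:Q_0\to\mathbb{N}$, here with all $\alpha(v)\ge1$; $\mathbf 1$ is the dimension vector equal to $1$ everywhere. The Euler form is $\chi_Q(\alpha,\beta)=\sum_{v}\alpha(v)\beta(v)-\sum_{a\in Q_1}\alpha(t(a))\beta(h(a))$, and $\varepsilon_v(w)=\delta_{vw}$. $Q$ is strongly connected if each pair of vertices belongs to an oriented cycle. A quiver setting is called simple if there exist simple representations over $\mathbb{C}$ of that dimension vector. A strongly connected quiver setting $(Q,\alpha)$ with at least $2$ vertices is reduced if: every vertex $t$ without loops satisfies $\chi_Q(\alpha,\varepsilon_t)\le-1$ and $\chi_Q(\varepsilon_t,\alpha)\le-1$; every vertex $t$ with exactly one loop satisfies $\chi_Q(\alpha,\varepsilon_t)\le-2$ and $\chi_Q(\varepsilon_t,\alpha)\le-2$; and no vertex of dimension $1$ has loops. Local quiver settings of $(Q,\alpha)$: for a semisimple $\alpha$-dimensional representation $S_1^{\oplus a_1}\oplus\dots\oplus S_k^{\oplus a_k}$ of $Q$, with $S_i$ pairwise non-isomorphic simples of dimension vector $\alpha_i$, the local quiver setting $(Q_p,\alpha_p)$ has $k$ vertices, $\delta_{ij}-\chi_Q(\alpha_i,\alpha_j)$ arrows from $i$ to $j$, and $\alpha_p=(a_1,\dots,a_k)$. $\tilde A_i$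 ($i\ge0$) is the oriented cycle with $i+1$ vertices ($\tilde A_0$ is a vertex with one loop). A quiver $Q$ is a connected sum of subquivers $R,S$ in $v$ if $Q_0=R_0\cup S_0$, $R_0\cap S_0=\{v\}$, $Q_1=R_1\cup S_1$, $R_1\cap S_1=\emptyset$; connected sums of several quivers are obtained by iteration. *)

theory Defs
  imports
    "HOL-Computational_Algebra.Polynomial"
    "Graph_Theory.Digraph_Component"
    "Graph_Theory.Digraph_Isomorphism"
    "Jordan_Normal_Form.VS_Connect"
begin

text \<open>
  A quiver is a \<^locale>\<open>fin_digraph\<close>: loops and parallel arrows are allowed. A dimension vector
  is a function on the vertex type of which only the values on the vertices of the quiver matter.
\<close>

definition arrows :: "('v, 'a) pre_digraph \<Rightarrow> 'v set \<Rightarrow> 'v set \<Rightarrow> 'a set" where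
  "arrows Q U W = {e \<in> arcs Q. tail Q e \<in> U \<and> head Q e \<in> W}"

definition loops :: "('v, 'a) pre_digraph \<Rightarrow> 'v \<Rightarrow> 'a set" where
  "loops Q v = arrows Q {v} {v}"

definition euler_form :: "('v, 'a) pre_digraph \<Rightarrow> ('v \<Rightarrow> nat) \<Rightarrow> ('v \<Rightarrow> nat) \<Rightarrow> int" where
  "euler_form Q \<alpha> \<beta> =
     (\<Sum>v\<in>verts Q. int (\<alpha> v) * int (\<beta> v)) - (\<Sum>e\<in>arcs Q. int (\<alpha> (tail Q e)) * int (\<beta> (head Q e)))"

definition unit_dim :: "'v \<Rightarrow> 'v \<Rightarrow> nat" where
  "unit_dim v = (\<lambda>w. if w = v then 1 else 0)"

definition quiver_setting :: "('v, 'a) pre_digraph \<Rightarrow> ('v \<Rightarrow> nat) \<Rightarrow> bool" where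
  "quiver_setting Q \<alpha> \<longleftrightarrow> fin_digraph Q \<and> (\<forall>v\<in>verts Q. 1 \<le> \<alpha> v)"

definition reduced_setting :: "('v, 'a) pre_digraph \<Rightarrow> ('v \<Rightarrow> nat) \<Rightarrow> bool" where
  "reduced_setting Q \<alpha> \<longleftrightarrow>
     quiver_setting Q \<alpha> \<and> strongly_connected Q \<and> 2 \<le> card (verts Q) \<and>
     (\<forall>t\<in>verts Q. loops Q t = {} \<longrightarrow>
        euler_form Q \<alpha> (unit_dim t) \<le> -1 \<and> euler_form Q (unit_dim t) \<alpha> \<le> -1) \<and>
     (\<forall>t\<in>verts Q. card (loops Q t) = 1 \<longrightarrow>
        euler_form Q \<alpha> (unit_dim t) \<le> -2 \<and> euler_form Q (unit_dim t) \<alpha> \<le> -2) \<and>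
     (\<forall>t\<in>verts Q. \<alpha> t = 1 \<longrightarrow> loops Q t = {})"


section \<open>Representations\<close>

record ('v, 'a, 'k) quiver_rep =
  rep_dim :: "'v \<Rightarrow> nat"
  rep_mat :: "'a \<Rightarrow> 'k mat"

definition is_rep :: "('v, 'a) pre_digraph \<Rightarrow> ('v, 'a, 'k::field) quiver_rep \<Rightarrow> bool" where
  "is_rep Q M \<longleftrightarrow>
     (\<forall>e\<in>arcs Q. rep_mat M e \<in> carrier_mat (rep_dim M (head Q e)) (rep_dim M (tail Q e)))"

definition subrep ::
  "('v, 'a) pre_digraph \<Rightarrow> ('v, 'a, 'k::field) quiver_rep \<Rightarrow> ('v \<Rightarrow> 'k vec set) \<Rightarrow> bool" where
  "subrep Q M W \<longleftrightarrow>
     (\<forall>v\<in>verts Q. VectorSpace.subspace class_ring (W v) (module_vec TYPE('k) (rep_dim M v))) \<and>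
     (\<forall>e\<in>arcs Q. \<forall>x\<in>W (tail Q e). rep_mat M e *\<^sub>v x \<in> W (head Q e))"

definition simple_rep :: "('v, 'a) pre_digraph \<Rightarrow> ('v, 'a, 'k::field) quiver_rep \<Rightarrow> bool" where
  "simple_rep Q M \<longleftrightarrow>
     is_rep Q M \<and> (\<exists>v\<in>verts Q. rep_dim M v \<noteq> 0) \<and>
     (\<forall>W. subrep Q M W \<longrightarrow>
        (\<forall>v\<in>verts Q. W v = {0\<^sub>v (rep_dim M v)}) \<or>
        (\<forall>v\<in>verts Q. W v = carrier_vec (rep_dim M v)))"

definition rep_iso ::
  "('v, 'a) pre_digraph \<Rightarrow> ('v, 'a, 'k::field) quiver_rep \<Rightarrow> ('v, 'a, 'k) quiver_rep \<Rightarrow> bool" where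
  "rep_iso Q M N \<longleftrightarrow>
     (\<forall>v\<in>verts Q. rep_dim M v = rep_dim N v) \<and>
     (\<exists>g. (\<forall>v\<in>verts Q. g v \<in> carrier_mat (rep_dim M v) (rep_dim M v) \<and> invertible_mat (g v)) \<and>
          (\<forall>e\<in>arcs Q. g (head Q e) * rep_mat M e = rep_mat N e * g (tail Q e)))"

definition rep_sum :: "('v, 'a, 'k::field) quiver_rep list \<Rightarrow> ('v, 'a, 'k) quiver_rep" where
  "rep_sum Ms =
     \<lparr>rep_dim = (\<lambda>v. sum_list (map (\<lambda>M. rep_dim M v) Ms)),
      rep_mat = (\<lambda>e. diag_block_mat (map (\<lambda>M. rep_mat M e) Ms))\<rparr>"

text \<open>\<open>M\<close> is isomorphic to the direct sum of \<open>a i\<close> copies of \<open>S i\<close>, for \<open>i < k\<close>.\<close>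

definition semisimple_decomposition ::
  "('v, 'a) pre_digraph \<Rightarrow> ('v, 'a, 'k::field) quiver_rep \<Rightarrow>
     nat \<Rightarrow> (nat \<Rightarrow> ('v, 'a, 'k) quiver_rep) \<Rightarrow> (nat \<Rightarrow> nat) \<Rightarrow> bool" where
  "semisimple_decomposition Q M k S a \<longleftrightarrow>
     is_rep Q M \<and>
     (\<forall>i<k. simple_rep Q (S i) \<and> 1 \<le> a i) \<and>
     (\<forall>i<k. \<forall>j<k. i \<noteq> j \<longrightarrow> \<not> rep_iso Q (S i) (S j)) \<and>
     rep_iso Q M (rep_sum (concat (map (\<lambda>i. replicate (a i) (S i)) [0..<k])))"

text \<open>The first argument \<open>K\<close> only serves to name the ground field.\<close>

definition simple_setting ::
  "'k::field itself \<Rightarrow> ('v, 'a) pre_digraph \<Rightarrow> ('v \<Rightarrow> nat) \<Rightarrow> bool" where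
  "simple_setting K Q \<alpha> \<longleftrightarrow>
     (\<exists>M :: ('v, 'a, 'k) quiver_rep. (\<forall>v\<in>verts Q. rep_dim M v = \<alpha> v) \<and> simple_rep Q M)"

text \<open>
  \<open>(R, \<beta>)\<close> is, up to a labelling \<open>\<phi>\<close> of the vertices of \<open>R\<close> by the simple summands, the local quiver
  setting of \<open>(Q, \<alpha>)\<close> at some semisimple representation \<open>M\<close>.
\<close>

definition local_setting ::
  "'k::field itself \<Rightarrow> ('v, 'a) pre_digraph \<Rightarrow> ('v \<Rightarrow> nat) \<Rightarrow>
     ('w, 'b) pre_digraph \<Rightarrow> ('w \<Rightarrow> nat) \<Rightarrow> bool" where
  "local_setting K Q \<alpha> R \<beta> \<longleftrightarrow>
     fin_digraph R \<and>
     (\<exists>(M :: ('v, 'a, 'k) quiver_rep) k S a \<phi>.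
        (\<forall>v\<in>verts Q. rep_dim M v = \<alpha> v) \<and>
        semisimple_decomposition Q M k S a \<and>
        bij_betw \<phi> {..<k} (verts R) \<and>
        (\<forall>i<k. \<beta> (\<phi> i) = a i) \<and>
        (\<forall>i<k. \<forall>j<k. int (card (arrows R {\<phi> i} {\<phi> j})) =
           (if i = j then 1 else 0) - euler_form Q (rep_dim (S i)) (rep_dim (S j))))"


section \<open>Connected sums of oriented cycles\<close>

definition cyclic_quiver :: "nat \<Rightarrow> (nat, nat) pre_digraph" where
  "cyclic_quiver i = \<lparr>verts = {..i}, arcs = {..i}, tail = (\<lambda>j. j), head = (\<lambda>j. Suc j mod Suc i)\<rparr>"

definition connected_sum ::
  "('v, 'a) pre_digraph \<Rightarrow> ('v, 'a) pre_digraph \<Rightarrow> ('v, 'a) pre_digraph \<Rightarrow> 'v \<Rightarrow> bool" where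
  "connected_sum Q R S v \<longleftrightarrow>
     subgraph R Q \<and> subgraph S Q \<and>
     verts Q = verts R \<union> verts S \<and> verts R \<inter> verts S = {v} \<and>
     arcs Q = arcs R \<union> arcs S \<and> arcs R \<inter> arcs S = {}"

inductive sum_of_cycles :: "('v, 'a) pre_digraph \<Rightarrow> bool" where
  cycle: "digraph_iso (cyclic_quiver i) R \<Longrightarrow> sum_of_cycles R"
| sum: "sum_of_cycles R \<Longrightarrow> sum_of_cycles S \<Longrightarrow> connected_sum Q R S v \<Longrightarrow> sum_of_cycles Q"

end

theory Submission
  imports Defs
begin

text \<open>
  A local setting with all multiplicities \<open>1\<close> is a decomposition \<open>\<alpha> = \<Sum>u. B u\<close> into dimension vectors
  of simple representations, one for each vertex of \<open>R\<close>, such that for \<open>u \<noteq> w\<close> the number of arrows of \<open>R\<close>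
  from \<open>u\<close> to \<open>w\<close> is minus the Euler form of \<open>B u\<close> and \<open>B w\<close>. A partition as in the theorem
  gives such a decomposition by extending simple representations by zero. The other direction amounts
  to showing that the supports of the \<open>B u\<close> are pairwise disjoint: then \<open>B u\<close> is the restriction of
  \<open>\<alpha>\<close> to its support, and minus the Euler form of \<open>B u\<close> and \<open>B w\<close> is the sum of the positive numbers
  \<open>\<alpha> (tail Q e) * \<alpha> (head Q e)\<close> over the arrows between the two supports. A connected sum of cycles
  has at most one arrow from \<open>u\<close> to \<open>w\<close>, so this sum is at most \<open>1\<close>, which leaves room only for
  arrows between vertices of dimension \<open>1\<close>.

  Disjointness is a question about two blocks only. Two vertices \<open>u \<noteq> w\<close> of a connected sum of cycles
  are separated by a vertex set \<open>X\<close> with exactly one arrow leaving and one arrow entering \<open>X\<close>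
  (\<open>sum_of_cycles_separate\<close>): cut open one cycle on the way from \<open>u\<close> to \<open>w\<close> at two places. With
  \<open>\<beta>\<close> the sum of the \<open>B i\<close> over \<open>X\<close> and \<open>\<gamma>\<close> the sum over the complement, \<open>\<alpha> = \<beta> + \<gamma>\<close> and the Euler form
  of \<open>\<beta>\<close> and \<open>\<gamma>\<close> is \<open>-1\<close> in both orders.

  Now put \<open>f v = - euler_form Q (unit_dim v) \<gamma>\<close> and \<open>g v = - euler_form Q (unit_dim v) \<beta>\<close>. These
  numbers are nonnegative. For a single simple summand this holds because the arrows
  leaving \<open>v\<close> have no common kernel (\<open>simple_rep_unit_form\<close>); the exception, a summand equal to
  \<open>unit_dim v\<close>, is harmless since only one arrow crosses the cut (\<open>block_unit_nonpos\<close>).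
  Hence \<open>\<Sum>v. \<beta> v * f v = 1\<close> says that \<open>f\<close> vanishes on the support of \<open>\<beta>\<close> except at one vertex,
  where \<open>\<beta>\<close> and \<open>f\<close> are \<open>1\<close>, and likewise for \<open>\<gamma>\<close> and \<open>g\<close>. On the other hand \<open>f + g \<ge> 1\<close> everywhere
  because the setting is reduced. So the supports share at most two vertices, and strong
  connectedness of \<open>Q\<close> together with reducedness rules out even one
  (\<open>complementary_blocks_disjoint\<close>).
\<close>

section \<open>The Euler form\<close>

lemma euler_form_cong:
  assumes "fin_digraph Q" and "\<And>v. v \<in> verts Q \<Longrightarrow> \<beta> v = \<beta>' v" and "\<And>v. v \<in> verts Q \<Longrightarrow> \<gamma> v = \<gamma>' v"
  shows "euler_form Q \<beta> \<gamma> = euler_form Q \<beta>' \<gamma>'"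
proof -
  interpret fin_digraph Q by fact
  show ?thesis unfolding euler_form_def using assms(2,3) by simp
qed

lemma euler_form_sum_left:
  "euler_form Q (\<lambda>v. \<Sum>i\<in>X. B i v) \<gamma> = (\<Sum>i\<in>X. euler_form Q (B i) \<gamma>)"
  unfolding euler_form_def sum_subtractf of_nat_sum sum_distrib_right
  by (intro arg_cong2[where f = minus] sum.swap)

lemma euler_form_sum_right:
  "euler_form Q \<gamma> (\<lambda>v. \<Sum>i\<in>X. B i v) = (\<Sum>i\<in>X. euler_form Q \<gamma> (B i))"
  unfolding euler_form_def sum_subtractf of_nat_sum sum_distrib_left
  by (intro arg_cong2[where f = minus] sum.swap)

lemma euler_form_add_right:
  "euler_form Q \<gamma> (\<lambda>v. \<beta> v + \<beta>' v) = euler_form Q \<gamma> \<beta> + euler_form Q \<gamma> \<beta>'"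
  unfolding euler_form_def by (simp add: algebra_simps sum.distrib)

lemma euler_form_unit_left:
  assumes "fin_digraph Q" and "v \<in> verts Q"
  shows "euler_form Q (unit_dim v) \<gamma> = int (\<gamma> v) - (\<Sum>e\<in>out_arcs Q v. int (\<gamma> (head Q e)))"
proof -
  interpret fin_digraph Q by fact
  have "(\<Sum>w\<in>verts Q. int (unit_dim v w) * int (\<gamma> w)) = (\<Sum>w\<in>verts Q. if w = v then int (\<gamma> w) else 0)"
    by (rule sum.cong) (auto simp: unit_dim_def)
  moreover have "(\<Sum>e\<in>arcs Q. int (unit_dim v (tail Q e)) * int (\<gamma> (head Q e)))
      = (\<Sum>e\<in>arcs Q. if tail Q e = v then int (\<gamma> (head Q e)) else 0)"
    by (rule sum.cong) (auto simp: unit_dim_def)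
  ultimately show ?thesis
    using assms(2) by (simp add: euler_form_def out_arcs_def sum.inter_filter)
qed

lemma euler_form_expand_left:
  assumes "fin_digraph Q"
  shows "euler_form Q \<beta> \<gamma> = (\<Sum>v\<in>verts Q. int (\<beta> v) * euler_form Q (unit_dim v) \<gamma>)"
proof -
  interpret fin_digraph Q by fact
  have "(\<Sum>e\<in>arcs Q. int (\<beta> (tail Q e)) * int (\<gamma> (head Q e)))
      = (\<Sum>v\<in>verts Q. \<Sum>e\<in>out_arcs Q v. int (\<beta> (tail Q e)) * int (\<gamma> (head Q e)))"
    unfolding out_arcs_def by (rule sum.group[symmetric]) auto
  also have "\<dots> = (\<Sum>v\<in>verts Q. int (\<beta> v) * (\<Sum>e\<in>out_arcs Q v. int (\<gamma> (head Q e))))"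
    unfolding sum_distrib_left by (intro sum.cong) (auto simp: out_arcs_def)
  finally show ?thesis
    unfolding euler_form_def[of Q \<beta>]
    by (simp add: euler_form_unit_left[OF assms] right_diff_distrib sum_subtractf)
qed

text \<open>
  Each loop at \<open>v\<close> is an arrow from \<open>v\<close> into a vertex of dimension \<open>\<gamma> v\<close>; the other arrows leaving \<open>v\<close>
  only lower the form further.
\<close>

lemma euler_form_unit_left_loop:
  assumes "fin_digraph Q" and "v \<in> verts Q"
  shows "euler_form Q (unit_dim v) \<gamma> \<le> (1 - int (card (loops Q v))) * int (\<gamma> v)"
proof -
  interpret fin_digraph Q by fact
  have "int (card (loops Q v)) * int (\<gamma> v) = (\<Sum>e\<in>loops Q v. int (\<gamma> (head Q e)))"
    by (simp add: loops_def arrows_def)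
  also have "\<dots> \<le> (\<Sum>e\<in>out_arcs Q v. int (\<gamma> (head Q e)))"
    by (rule sum_mono2) (auto simp: loops_def arrows_def)
  finally show ?thesis
    by (simp add: euler_form_unit_left[OF assms] algebra_simps)
qed

text \<open>
  Reducedness speaks of vertices with no loop and with one loop. It also excludes loops at
  vertices of dimension \<open>1\<close>, so with two or more loops at \<open>v\<close> the form is at most \<open>- \<alpha> v\<close>, hence at most \<open>-2\<close>, and
  the bounds hold at all vertices.
\<close>

lemma reduced_unit_bound:
  assumes "reduced_setting Q \<alpha>" and "v \<in> verts Q"
  shows "euler_form Q (unit_dim v) \<alpha> \<le> -1"
    and "loops Q v \<noteq> {} \<Longrightarrow> euler_form Q (unit_dim v) \<alpha> \<le> -2"
proof -
  have fd: "fin_digraph Q" and pos: "1 \<le> \<alpha> v"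
    using assms by (auto simp: reduced_setting_def quiver_setting_def)
  interpret fin_digraph Q by fact
  have fin: "finite (loops Q v)"
    by (simp add: loops_def arrows_def)
  show two: "euler_form Q (unit_dim v) \<alpha> \<le> -2" if ne: "loops Q v \<noteq> {}"
  proof (cases "card (loops Q v) = 1")
    case True
    then show ?thesis using assms by (auto simp: reduced_setting_def)
  next
    case False
    have "card (loops Q v) \<noteq> 0" using fin ne by simp
    with False have l: "2 \<le> int (card (loops Q v))" by linarith
    have "\<alpha> v \<noteq> 1" using assms ne by (auto simp: reduced_setting_def)
    then have a: "2 \<le> int (\<alpha> v)" using pos by simp
    have "1 * 2 \<le> (int (card (loops Q v)) - 1) * int (\<alpha> v)"
      by (rule mult_mono) (use l a in auto)
    then show ?thesis
      using euler_form_unit_left_loop[OF fd assms(2), of \<alpha>] by (simp add: algebra_simps)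
  qed
  show "euler_form Q (unit_dim v) \<alpha> \<le> -1"
    using two assms by (cases "loops Q v = {}") (auto simp: reduced_setting_def)
qed

section \<open>Simple representations\<close>

lemma subspace_module_vec_iff:
  "VectorSpace.subspace class_ring W (module_vec TYPE('k::field) n) \<longleftrightarrow>
     W \<subseteq> carrier_vec n \<and> 0\<^sub>v n \<in> W \<and> (\<forall>x\<in>W. \<forall>y\<in>W. x + y \<in> W) \<and>
     (\<forall>c. \<forall>x\<in>W. c \<cdot>\<^sub>v x \<in> W)"
proof -
  have "vectorspace class_ring (module_vec TYPE('k) n)" by (rule vec_vs)
  moreover from this have "Module.module class_ring (module_vec TYPE('k) n)"
    by (simp add: vectorspace_def)
  ultimately show ?thesis
    unfolding subspace_def submodule_def module_vec_simps class_ring_simps by auto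
qed

lemma mult_mat_vec_zero: "A \<in> carrier_mat m n \<Longrightarrow> A *\<^sub>v 0\<^sub>v n = 0\<^sub>v m"
  for A :: "'k::field mat"
  by (rule eq_vecI) auto

lemma smult_vec_zero: "c \<cdot>\<^sub>v 0\<^sub>v n = 0\<^sub>v n"
  for c :: "'k::field"
  by (rule eq_vecI) simp_all

text \<open>
  Fewer than \<open>n\<close> linear conditions on a vector of length \<open>n\<close> have a common nonzero solution: padded
  with zero rows they form a singular square matrix.
\<close>

lemma common_orthogonal_vec:
  fixes rs :: "'k::field vec list"
  assumes "set rs \<subseteq> carrier_vec n" and "length rs < n"
  shows "\<exists>x\<in>carrier_vec n. x \<noteq> 0\<^sub>v n \<and> (\<forall>r\<in>set rs. r \<bullet> x = 0)"
proof -
  define c where "c i = (if i < length rs then rs ! i else 0\<^sub>v n)" for i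
  have c: "c i \<in> carrier_vec n" for i
    using assms(1) by (auto simp: c_def)
  \<comment> \<open>Row \<open>length rs\<close> is one of the padding rows, which makes the determinant vanish.\<close>
  let ?A = "mat\<^sub>r n n (\<lambda>i. if i = length rs then 0\<^sub>v n else c i)"
  have A: "?A \<in> carrier_mat n n" by simp
  have "det ?A = 0"
    by (rule det_row_0) (use assms(2) c in auto)
  then obtain x where x: "x \<in> carrier_vec n" "x \<noteq> 0\<^sub>v n" "?A *\<^sub>v x = 0\<^sub>v n"
    using det_0_iff_vec_prod_zero[OF A] by blast
  have "r \<bullet> x = 0" if r: "r \<in> set rs" for r
  proof -
    obtain i where i: "i < length rs" "r = rs ! i" using r by (metis in_set_conv_nth)
    have "row ?A i \<bullet> x = (?A *\<^sub>v x) $ i" using i assms(2) by simp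
    also have "\<dots> = 0" using x(3) i assms(2) by simp
    also have "row ?A i = (if i = length rs then 0\<^sub>v n else c i)"
      using i assms(2) c by (intro row_mat_of_row_fun) auto
    also have "\<dots> = r" using i by (simp add: c_def)
    finally show ?thesis .
  qed
  then show ?thesis using x by blast
qed

text \<open>
  If \<open>euler_form Q (unit_dim v) (rep_dim M) > 0\<close>, the space at \<open>v\<close> is larger than all the spaces
  reached from \<open>v\<close> by one arrow together. Then some nonzero vector at \<open>v\<close> is killed by every arrow
  leaving \<open>v\<close>, and the line that it spans, with zero at the other vertices, is a subrepresentation.
  By simplicity it is the whole of \<open>M\<close>.
\<close>

lemma simple_rep_unit_form:
  fixes M :: "('v, 'a, 'k::field) quiver_rep"
  assumes "fin_digraph Q" and simple: "simple_rep Q M" and v: "v \<in> verts Q"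
  shows "euler_form Q (unit_dim v) (rep_dim M) \<le> 0 \<or> (\<forall>x\<in>verts Q. rep_dim M x = unit_dim v x)"
proof (subst disj_commute, rule disjCI)
  interpret fin_digraph Q by fact
  let ?n = "rep_dim M v"
  assume "\<not> euler_form Q (unit_dim v) (rep_dim M) \<le> 0"
  then have "int (\<Sum>e\<in>out_arcs Q v. rep_dim M (head Q e)) < int ?n"
    by (simp add: euler_form_unit_left[OF assms(1) v])
  then have less: "(\<Sum>e\<in>out_arcs Q v. rep_dim M (head Q e)) < ?n" by (simp only: of_nat_less_iff)
  have mat: "rep_mat M e \<in> carrier_mat (rep_dim M (head Q e)) (rep_dim M (tail Q e))"
    if "e \<in> arcs Q" for e
    using simple that by (auto simp: simple_rep_def is_rep_def)
  obtain es where es: "set es = out_arcs Q v" "distinct es"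
    using finite_distinct_list[of "out_arcs Q v"] by auto
  define rs where "rs = concat (map (\<lambda>e. rows (rep_mat M e)) es)"
  have "set rs \<subseteq> carrier_vec ?n"
  proof
    fix r assume "r \<in> set rs"
    then obtain e where e: "e \<in> arcs Q" "tail Q e = v" "r \<in> set (rows (rep_mat M e))"
      using es(1) by (auto simp: rs_def)
    then show "r \<in> carrier_vec ?n"
      using rows_carrier[of "rep_mat M e"] mat[OF e(1)] by auto
  qed
  moreover have "length rs = (\<Sum>e\<in>out_arcs Q v. rep_dim M (head Q e))"
  proof -
    have "length rs = (\<Sum>e\<leftarrow>es. dim_row (rep_mat M e))"
      by (simp add: rs_def length_concat comp_def)
    also have "\<dots> = (\<Sum>e\<in>out_arcs Q v. dim_row (rep_mat M e))"
      using es by (simp add: sum_list_distinct_conv_sum_set)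
    also have "\<dots> = (\<Sum>e\<in>out_arcs Q v. rep_dim M (head Q e))"
      using mat by (intro sum.cong) auto
    finally show ?thesis .
  qed
  ultimately obtain x where x: "x \<in> carrier_vec ?n" "x \<noteq> 0\<^sub>v ?n" "\<And>r. r \<in> set rs \<Longrightarrow> r \<bullet> x = 0"
    using common_orthogonal_vec[of rs ?n] less by auto
  have kill: "rep_mat M e *\<^sub>v x = 0\<^sub>v (rep_dim M (head Q e))" if e: "e \<in> arcs Q" "tail Q e = v" for e
  proof (rule eq_vecI)
    have "set (rows (rep_mat M e)) \<subseteq> set rs"
      using es(1) e by (auto simp: rs_def)
    then have "row (rep_mat M e) i \<in> set rs" if "i < dim_row (rep_mat M e)" for i
      using that by (auto simp: rows_def)
    then show "(rep_mat M e *\<^sub>v x) $ i = 0\<^sub>v (rep_dim M (head Q e)) $ i"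
      if "i < dim_vec (0\<^sub>v (rep_dim M (head Q e)) :: 'k vec)" for i
      using that mat[OF e(1)] x(3) by auto
    show "dim_vec (rep_mat M e *\<^sub>v x) = dim_vec (0\<^sub>v (rep_dim M (head Q e)) :: 'k vec)"
      using mat[OF e(1)] by auto
  qed
  define W where "W w = (if w = v then range (\<lambda>c. c \<cdot>\<^sub>v x) else {0\<^sub>v (rep_dim M w)})" for w
  have zero: "0\<^sub>v (rep_dim M w) \<in> W w" for w
    using x(1) by (auto simp: W_def intro!: image_eqI[of _ _ 0])
  have "subrep Q M W"
    unfolding subrep_def subspace_module_vec_iff
  proof (intro conjI ballI allI zero)
    fix w
    show "W w \<subseteq> carrier_vec (rep_dim M w)" using x(1) by (auto simp: W_def)
    fix y z c assume y: "y \<in> W w"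
    show "c \<cdot>\<^sub>v y \<in> W w" using y by (auto simp: W_def smult_smult_assoc)
    assume "z \<in> W w"
    with y show "y + z \<in> W w" by (auto simp: W_def add_smult_distrib_vec[symmetric])
  next
    fix e y assume e: "e \<in> arcs Q" and y: "y \<in> W (tail Q e)"
    have "rep_mat M e *\<^sub>v y = 0\<^sub>v (rep_dim M (head Q e))"
    proof (cases "tail Q e = v")
      case True
      then obtain c where "y = c \<cdot>\<^sub>v x" using y by (auto simp: W_def)
      then have "rep_mat M e *\<^sub>v y = c \<cdot>\<^sub>v 0\<^sub>v (rep_dim M (head Q e))"
        using kill[OF e True] mat[OF e] x(1) True by (simp add: mult_mat_vec)
      also have "\<dots> = 0\<^sub>v (rep_dim M (head Q e))" by (rule smult_vec_zero)
      finally show ?thesis .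
    next
      case False
      then have "y = 0\<^sub>v (rep_dim M (tail Q e))" using y by (simp add: W_def)
      then show ?thesis using mult_mat_vec_zero[OF mat[OF e]] by simp
    qed
    then show "rep_mat M e *\<^sub>v y \<in> W (head Q e)" using zero by simp
  qed
  moreover have "x \<in> W v" by (auto simp: W_def intro!: image_eqI[of _ _ 1])
  then have "W v \<noteq> {0\<^sub>v ?n}" using x(2) by auto
  ultimately have all: "\<And>w. w \<in> verts Q \<Longrightarrow> W w = carrier_vec (rep_dim M w)"
    using simple v by (auto simp: simple_rep_def)
  have "rep_dim M w = 0" if "w \<in> verts Q" "w \<noteq> v" for w
  proof (rule ccontr)
    assume "rep_dim M w \<noteq> 0"
    then have "unit_vec (rep_dim M w) 0 $ 0 \<noteq> (0\<^sub>v (rep_dim M w) :: 'k vec) $ 0" by simp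
    then have "unit_vec (rep_dim M w) 0 \<noteq> (0\<^sub>v (rep_dim M w) :: 'k vec)" by metis
    moreover have "unit_vec (rep_dim M w) 0 \<in> W w" using all[OF that(1)] by simp
    ultimately show False using that by (simp add: W_def)
  qed
  moreover have "?n = 1"
  proof (rule ccontr)
    assume "?n \<noteq> 1"
    \<comment> \<open>The first two unit vectors would be multiples of the same vector \<open>x\<close>.\<close>
    then have n: "1 < ?n" using less by linarith
    have "unit_vec ?n 0 \<in> W v" "unit_vec ?n 1 \<in> W v" using all[OF v] by simp_all
    then obtain c d where c: "unit_vec ?n 0 = c \<cdot>\<^sub>v x" and d: "unit_vec ?n 1 = d \<cdot>\<^sub>v x"
      by (auto simp: W_def)
    have "c * x $ 0 = 1" "c * x $ 1 = 0" "d * x $ 1 = 1"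
      using n x(1) arg_cong[OF c, of "\<lambda>y. y $ 0"] arg_cong[OF c, of "\<lambda>y. y $ 1"]
        arg_cong[OF d, of "\<lambda>y. y $ 1"] by (simp_all add: unit_vec_def)
    then show False by auto
  qed
  ultimately show "\<forall>x\<in>verts Q. rep_dim M x = unit_dim v x"
    by (auto simp: unit_dim_def)
qed

section \<open>Two complementary blocks\<close>

lemma strongly_connected_out_closed:
  assumes "strongly_connected Q" and "T \<subseteq> verts Q" and "T \<noteq> {}"
    and closed: "\<And>e. e \<in> arcs Q \<Longrightarrow> tail Q e \<in> T \<Longrightarrow> head Q e \<in> T"
  shows "T = verts Q"
proof -
  obtain t where t: "t \<in> T" using assms(3) by auto
  have "x \<in> T" if "t \<rightarrow>\<^sup>*\<^bsub>Q\<^esub> x" for x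
    using that[unfolded reachable_def]
  proof (induction rule: rtrancl_on_induct)
    case base
    show ?case by fact
  next
    case (step y z)
    then show ?case using closed by (force simp: arcs_ends_def arc_to_ends_def)
  qed
  then show ?thesis
    using assms(1,2) t by (force simp: strongly_connected_def)
qed

lemma weighted_sum_eq_one:
  fixes f :: "'x \<Rightarrow> int" and b :: "'x \<Rightarrow> nat"
  assumes "finite A" and "(\<Sum>x\<in>A. int (b x) * f x) = 1" and "\<And>x. x \<in> A \<Longrightarrow> 0 \<le> f x"
    and "p \<in> A" and "b p \<noteq> 0" and "f p \<noteq> 0"
  shows "b p = 1 \<and> f p = 1 \<and> (\<forall>x\<in>A. x \<noteq> p \<longrightarrow> b x \<noteq> 0 \<longrightarrow> f x = 0)"
proof -
  have eq: "int (b p) * f p + (\<Sum>x\<in>A - {p}. int (b x) * f x) = 1"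
    using assms(1,2,4) by (simp add: sum.remove)
  have nn: "0 \<le> int (b x) * f x" if "x \<in> A" for x
    using that assms(3) by simp
  have rest: "0 \<le> (\<Sum>x\<in>A - {p}. int (b x) * f x)"
    using nn by (intro sum_nonneg) auto
  have "0 < f p" using assms(3,4,6) by force
  then have pos: "0 < int (b p) * f p" using assms(5) by simp
  then have 1: "int (b p) * f p = 1" and 0: "(\<Sum>x\<in>A - {p}. int (b x) * f x) = 0"
    using eq rest by linarith+
  have "\<forall>x\<in>A - {p}. int (b x) * f x = 0"
    using 0 nn assms(1) by (subst (asm) sum_nonneg_eq_0_iff) auto
  then have "\<forall>x\<in>A. x \<noteq> p \<longrightarrow> b x \<noteq> 0 \<longrightarrow> f x = 0" by force
  moreover have "b p = 1" "f p = 1" using 1 \<open>0 < f p\<close> by (auto simp: zmult_eq_1_iff)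
  ultimately show ?thesis by blast
qed

text \<open>
  One half of the two-block argument. The expansion of \<open>euler_form Q \<beta> \<gamma>\<close> in the \<open>unit_dim x\<close> has a
  single nonzero summand. If that summand sits at a vertex in both supports, no arrow leads from
  the zero set of \<open>\<gamma>\<close> into the support of \<open>\<gamma>\<close>, so by strong connectedness this zero set is empty.
\<close>

lemma block_support_subset:
  assumes "fin_digraph Q" and "strongly_connected Q"
    and cover: "\<And>x. x \<in> verts Q \<Longrightarrow> \<beta> x \<noteq> 0 \<or> \<gamma> x \<noteq> 0"
    and form: "euler_form Q \<beta> \<gamma> = -1"
    and nonpos: "\<And>x. x \<in> verts Q \<Longrightarrow> euler_form Q (unit_dim x) \<gamma> \<le> 0"
    and v: "v \<in> verts Q" "\<beta> v \<noteq> 0" "\<gamma> v \<noteq> 0" "euler_form Q (unit_dim v) \<gamma> \<noteq> 0"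
  shows "\<beta> v = 1 \<and> euler_form Q (unit_dim v) \<gamma> = -1 \<and>
    (\<forall>x\<in>verts Q. x \<noteq> v \<longrightarrow> \<beta> x \<noteq> 0 \<longrightarrow> euler_form Q (unit_dim x) \<gamma> = 0) \<and>
    (\<forall>x\<in>verts Q. \<gamma> x \<noteq> 0)"
proof -
  interpret fin_digraph Q by fact
  have "(\<Sum>x\<in>verts Q. int (\<beta> x) * - euler_form Q (unit_dim x) \<gamma>) = 1"
    using form euler_form_expand_left[OF assms(1), of \<beta> \<gamma>] by (simp add: sum_negf)
  from weighted_sum_eq_one[OF _ this _ v(1,2)] nonpos v(4)
  have main: "\<beta> v = 1" "euler_form Q (unit_dim v) \<gamma> = -1"
    and zero: "\<And>x. x \<in> verts Q \<Longrightarrow> x \<noteq> v \<Longrightarrow> \<beta> x \<noteq> 0 \<Longrightarrow> euler_form Q (unit_dim x) \<gamma> = 0"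
    by fastforce+
  \<comment> \<open>\<open>T\<close> lies in the support of \<open>\<beta>\<close> and misses \<open>v\<close>, so the form with \<open>\<gamma>\<close> vanishes on it.\<close>
  define T where "T = {x \<in> verts Q. \<gamma> x = 0}"
  have closed: "head Q e \<in> T" if e: "e \<in> arcs Q" "tail Q e \<in> T" for e
  proof -
    let ?x = "tail Q e"
    have x: "?x \<in> verts Q" "\<gamma> ?x = 0" using e by (auto simp: T_def)
    then have "euler_form Q (unit_dim ?x) \<gamma> = 0" using zero cover v(3) by metis
    then have "(\<Sum>e'\<in>out_arcs Q ?x. int (\<gamma> (head Q e'))) = 0"
      using euler_form_unit_left[OF assms(1) x(1), of \<gamma>] x(2) by simp
    then have "\<forall>e'\<in>out_arcs Q ?x. int (\<gamma> (head Q e')) = 0"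
      by (subst (asm) sum_nonneg_eq_0_iff) auto
    then show ?thesis using e by (auto simp: T_def)
  qed
  have "v \<notin> T" "T \<subseteq> verts Q" using v(3) by (auto simp: T_def)
  then have "T = {}"
    using strongly_connected_out_closed[OF assms(2) _ _ closed] v(1) by blast
  then show ?thesis using main zero by (auto simp: T_def)
qed

text \<open>
  By reducedness, at a vertex \<open>v\<close> in both supports one of the two blocks has a nonzero form with
  \<open>unit_dim v\<close>. Call this block \<open>c\<close> and the other one \<open>b\<close>. The support of \<open>c\<close> is all of \<open>Q\<close>. If
  the form with \<open>b\<close> vanishes at all vertices in the support of \<open>b\<close>, this support is \<open>{v}\<close>, with no loop at
  \<open>v\<close>, which makes the form with \<open>b\<close> positive at \<open>v\<close>. Otherwise the support of \<open>b\<close> is all of \<open>Q\<close> too,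
  and reducedness leaves only two vertices, without loops; counting arrows then shows that the form
  with \<open>c\<close> vanishes at \<open>v\<close> after all.
\<close>

lemma complementary_blocks_disjoint:
  assumes red: "reduced_setting Q \<alpha>"
    and split: "\<And>x. x \<in> verts Q \<Longrightarrow> \<alpha> x = \<beta> x + \<gamma> x"
    and form: "euler_form Q \<beta> \<gamma> = -1" "euler_form Q \<gamma> \<beta> = -1"
    and nonpos: "\<And>x. x \<in> verts Q \<Longrightarrow> euler_form Q (unit_dim x) \<beta> \<le> 0"
      "\<And>x. x \<in> verts Q \<Longrightarrow> euler_form Q (unit_dim x) \<gamma> \<le> 0"
    and v: "v \<in> verts Q"
  shows "\<beta> v = 0 \<or> \<gamma> v = 0"
proof (rule ccontr)
  assume "\<not> ?thesis"
  then have both: "\<beta> v \<noteq> 0" "\<gamma> v \<noteq> 0" by auto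
  have fd: "fin_digraph Q" and sc: "strongly_connected Q" and two: "2 \<le> card (verts Q)"
    and pos: "\<And>x. x \<in> verts Q \<Longrightarrow> 1 \<le> \<alpha> x"
    using red by (auto simp: reduced_setting_def quiver_setting_def)
  interpret fin_digraph Q by fact
  have sum: "euler_form Q (unit_dim x) \<alpha> = euler_form Q (unit_dim x) \<beta> + euler_form Q (unit_dim x) \<gamma>" for x
    using euler_form_cong[OF fd _ split, of "unit_dim x" "unit_dim x"] by (simp add: euler_form_add_right)
  \<comment> \<open>The situation is symmetric in the two blocks, so the contradiction is derived for either order of them.\<close>
  have *: False
    if cover: "\<And>x. x \<in> verts Q \<Longrightarrow> b x \<noteq> 0 \<or> c x \<noteq> 0"
      and form: "euler_form Q b c = -1" "euler_form Q c b = -1"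
      and nb: "\<And>x. x \<in> verts Q \<Longrightarrow> euler_form Q (unit_dim x) b \<le> 0"
      and nc: "\<And>x. x \<in> verts Q \<Longrightarrow> euler_form Q (unit_dim x) c \<le> 0"
      and sum: "\<And>x. euler_form Q (unit_dim x) \<alpha> = euler_form Q (unit_dim x) b + euler_form Q (unit_dim x) c"
      and bv: "b v \<noteq> 0" and cv: "c v \<noteq> 0" and n0: "euler_form Q (unit_dim v) c \<noteq> 0"
    for b c
  proof -
    note bound1 = reduced_unit_bound(1)[OF red, unfolded sum]
    note bound2 = reduced_unit_bound(2)[OF red, unfolded sum]
    from block_support_subset[OF fd sc cover form(1) nc v bv cv n0]
    have b1: "b v = 1" and c1: "euler_form Q (unit_dim v) c = -1"
      and c0: "\<And>x. x \<in> verts Q \<Longrightarrow> x \<noteq> v \<Longrightarrow> b x \<noteq> 0 \<Longrightarrow> euler_form Q (unit_dim x) c = 0"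
      and full: "\<And>x. x \<in> verts Q \<Longrightarrow> c x \<noteq> 0"
      by auto
    show False
    proof (cases "\<exists>w\<in>verts Q. b w \<noteq> 0 \<and> euler_form Q (unit_dim w) b \<noteq> 0")
      case False
      then have b0: "\<And>x. x \<in> verts Q \<Longrightarrow> b x \<noteq> 0 \<Longrightarrow> euler_form Q (unit_dim x) b = 0" by blast
      have only: "b x = 0" if "x \<in> verts Q" "x \<noteq> v" for x
        using bound1[OF that(1)] b0 c0 that by fastforce
      have "loops Q v = {}" using bound2[OF v] b0[OF v bv] c1 by fastforce
      then have "head Q e \<noteq> v" if "e \<in> out_arcs Q v" for e
        using that by (auto simp: loops_def arrows_def)
      then have "(\<Sum>e\<in>out_arcs Q v. int (b (head Q e))) = 0"
        using only by (intro sum.neutral) auto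
      then show False using b0[OF v bv] b1 euler_form_unit_left[OF fd v, of b] by simp
    next
      case True
      then obtain w where w: "w \<in> verts Q" "b w \<noteq> 0" "euler_form Q (unit_dim w) b \<noteq> 0" by blast
      from block_support_subset[OF fd sc _ form(2) nb w(1) full[OF w(1)] w(2,3)] cover
      have cw: "c w = 1" and b0: "\<And>x. x \<in> verts Q \<Longrightarrow> x \<noteq> w \<Longrightarrow> euler_form Q (unit_dim x) b = 0"
        and fullb: "\<And>x. x \<in> verts Q \<Longrightarrow> b x \<noteq> 0" and bw: "euler_form Q (unit_dim w) b = -1"
        using full by fastforce+
      have vs: "verts Q = {v, w}"
        using bound1 b0 c0 fullb v w(1) by fastforce
      then have ne: "v \<noteq> w" using two by auto
      have bv0: "euler_form Q (unit_dim v) b = 0" using b0 v ne by blast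
      have cw0: "euler_form Q (unit_dim w) c = 0" using c0 w ne by blast
      have "loops Q v = {}" using bound2[OF v] bv0 c1 by fastforce
      then have hv: "head Q e = w" if "e \<in> out_arcs Q v" for e
        using that vs by (force simp: loops_def arrows_def)
      have "loops Q w = {}" using bound2[OF w(1)] cw0 bw by fastforce
      then have hw: "head Q e = v" if "e \<in> out_arcs Q w" for e
        using that vs by (force simp: loops_def arrows_def)
      \<comment> \<open>All arrows from \<open>v\<close> go to \<open>w\<close>; as \<open>b\<close> is balanced at \<open>v\<close>, there is exactly one.\<close>
      have "int (card (out_arcs Q v)) * int (b w) = 1"
        using bv0 b1 hv by (simp add: euler_form_unit_left[OF fd v])
      then have n: "card (out_arcs Q v) = 1"
        by (metis of_nat_1_eq_iff of_nat_mult nat_mult_eq_1_iff)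
      have "euler_form Q (unit_dim v) c = int (c v) - 1"
        using hv n cw by (simp add: euler_form_unit_left[OF fd v])
      then show False using c1 cv by simp
    qed
  qed
  have cover: "\<beta> x \<noteq> 0 \<or> \<gamma> x \<noteq> 0" if "x \<in> verts Q" for x
    using split[OF that] pos[OF that] by auto
  show False
  proof (cases "euler_form Q (unit_dim v) \<gamma> = 0")
    case False
    show ?thesis
      by (rule *[of \<beta> \<gamma>, OF cover form nonpos sum both False])
  next
    case True
    then have n0: "euler_form Q (unit_dim v) \<beta> \<noteq> 0"
      using reduced_unit_bound(1)[OF red v] sum[of v] by simp
    have cover': "\<gamma> x \<noteq> 0 \<or> \<beta> x \<noteq> 0" if "x \<in> verts Q" for x
      using cover[OF that] by blast
    have sum': "euler_form Q (unit_dim x) \<alpha> = euler_form Q (unit_dim x) \<gamma> + euler_form Q (unit_dim x) \<beta>" for x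
      using sum[of x] by simp
    show ?thesis
      by (rule *[of \<gamma> \<beta>, OF cover' form(2,1) nonpos(2,1) sum' both(2,1) n0])
  qed
qed

section \<open>Cuts of connected sums of cycles\<close>

definition two_arrow_cut :: "('w, 'b) pre_digraph \<Rightarrow> 'w set \<Rightarrow> bool" where
  "two_arrow_cut R X \<longleftrightarrow> X \<subseteq> verts R \<and>
     card (arrows R X (verts R - X)) = 1 \<and> card (arrows R (verts R - X) X) = 1"

lemma two_arrow_cut_complement:
  assumes "two_arrow_cut R X"
  shows "two_arrow_cut R (verts R - X)"
  using assms by (auto simp: two_arrow_cut_def double_diff)

lemma fin_digraph_cyclic_quiver: "fin_digraph (cyclic_quiver n)"
  by unfold_locales (auto simp: cyclic_quiver_def mod_Suc)

lemma cyclic_quiver_cut: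
  assumes "p < q" and "q \<le> n"
  shows "two_arrow_cut (cyclic_quiver n) {p..<q}"
proof -
  let ?C = "cyclic_quiver n" and ?X = "{p..<q}"
  have arrows: "arrows ?C Y Z = {j. j \<le> n \<and> j \<in> Y \<and> (if j = n then 0 else Suc j) \<in> Z}" for Y Z
  proof (rule Set.set_eqI)
    fix j
    show "j \<in> arrows ?C Y Z \<longleftrightarrow> j \<in> {j. j \<le> n \<and> j \<in> Y \<and> (if j = n then 0 else Suc j) \<in> Z}"
      by (cases j n rule: linorder_cases) (simp_all add: arrows_def cyclic_quiver_def)
  qed
  have verts: "verts ?C = {..n}"
    by (simp add: cyclic_quiver_def)
  \<comment> \<open>The arrow \<open>j\<close> starts in the vertex \<open>j\<close>. The one that enters the arc starts just before \<open>p\<close>, cyclically.\<close>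
  have "arrows ?C ?X (verts ?C - ?X) = {q - 1}"
    unfolding arrows verts using assms by (auto split: if_splits)
  moreover have "arrows ?C (verts ?C - ?X) ?X = {if p = 0 then n else p - 1}"
    unfolding arrows verts using assms by (auto split: if_splits)
  ultimately show ?thesis
    using assms by (auto simp: two_arrow_cut_def verts)
qed

lemma two_arrow_cut_app_iso:
  assumes "pre_digraph.digraph_isomorphism G f" and "two_arrow_cut G X"
  shows "two_arrow_cut (app_iso f G) (iso_verts f ` X)"
proof -
  note iso = assms(1)[unfolded pre_digraph.digraph_isomorphism_def]
  interpret wf_digraph G using iso by blast
  have inj: "inj_on (iso_verts f) (verts G)" "inj_on (iso_arcs f) (arcs G)" using iso by auto
  have ends: "iso_tail f (iso_arcs f a) = iso_verts f (tail G a)"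
    "iso_head f (iso_arcs f a) = iso_verts f (head G a)" if "a \<in> arcs G" for a
    using iso that by auto
  have card: "card (arrows (app_iso f G) (iso_verts f ` Y) (iso_verts f ` Z)) = card (arrows G Y Z)"
    if "Y \<subseteq> verts G" "Z \<subseteq> verts G" for Y Z
  proof -
    have "arrows (app_iso f G) (iso_verts f ` Y) (iso_verts f ` Z) = iso_arcs f ` arrows G Y Z"
    proof -
      have mem: "iso_arcs f a \<in> arrows (app_iso f G) (iso_verts f ` Y) (iso_verts f ` Z) \<longleftrightarrow> a \<in> arrows G Y Z"
        if "a \<in> arcs G" for a
        using that ends[OF that] inj_on_image_mem_iff[OF inj(1) _ \<open>Y \<subseteq> verts G\<close>]
          inj_on_image_mem_iff[OF inj(1) _ \<open>Z \<subseteq> verts G\<close>] by (simp add: arrows_def)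
      have "arrows (app_iso f G) (iso_verts f ` Y) (iso_verts f ` Z) \<subseteq> iso_arcs f ` arcs G"
        by (auto simp: arrows_def)
      moreover have "arrows G Y Z \<subseteq> arcs G"
        by (auto simp: arrows_def)
      ultimately show ?thesis using mem by blast
    qed
    moreover have "inj_on (iso_arcs f) (arrows G Y Z)"
      using inj(2) by (rule inj_on_subset) (auto simp: arrows_def)
    ultimately show ?thesis by (simp add: card_image)
  qed
  have X: "X \<subseteq> verts G" using assms(2) by (simp add: two_arrow_cut_def)
  have "iso_verts f ` verts G - iso_verts f ` X = iso_verts f ` (verts G - X)"
    using inj_on_image_set_diff[OF inj(1), of "verts G" X] X by auto
  then show ?thesis
    using assms(2) X by (auto simp: two_arrow_cut_def card)
qed

text \<open>
  The second summand is attached at \<open>v\<close> only, so outside \<open>X\<close>; its arrows do not meet \<open>X\<close>.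
\<close>

lemma two_arrow_cut_connected_sum:
  assumes sum: "connected_sum Q R S v" and cut: "two_arrow_cut R X" and v: "v \<notin> X"
  shows "two_arrow_cut Q X"
proof -
  note s = sum[unfolded connected_sum_def subgraph_def compatible_def]
  have X: "X \<subseteq> verts R" using cut by (simp add: two_arrow_cut_def)
  have disj: "x \<notin> verts S" if "x \<in> X" for x using s X v that by auto
  have R: "tail Q e \<in> verts R \<and> head Q e \<in> verts R" if "e \<in> arcs R" for e
    using s that by (metis wf_digraph.tail_in_verts wf_digraph.head_in_verts)
  have S: "tail Q e \<in> verts S \<and> head Q e \<in> verts S" if "e \<in> arcs S" for e
    using s that by (metis wf_digraph.tail_in_verts wf_digraph.head_in_verts)
  have "arrows Q X (verts Q - X) = arrows R X (verts R - X)"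
    using s X disj R S by (auto simp: arrows_def)
  moreover have "arrows Q (verts Q - X) X = arrows R (verts R - X) X"
    using s X disj R S by (auto simp: arrows_def)
  ultimately show ?thesis
    using cut s by (auto simp: two_arrow_cut_def)
qed

lemma sum_of_cycles_fin_digraph:
  assumes "sum_of_cycles R"
  shows "fin_digraph R"
  using assms
proof induction
  case (cycle i R)
  then obtain f where f: "pre_digraph.digraph_isomorphism (cyclic_quiver i) f"
    "R = app_iso f (cyclic_quiver i)" by (auto simp: digraph_iso_def)
  interpret fin_digraph "cyclic_quiver i" by (rule fin_digraph_cyclic_quiver)
  show ?case using f fin_digraphI_app_iso by blast
next
  case (sum R S Q v)
  then interpret R: fin_digraph R + S: fin_digraph S by simp_all
  show ?case
    using sum.hyps(3) R.finite_verts S.finite_verts R.finite_arcs S.finite_arcs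
    by (auto simp: connected_sum_def subgraph_def fin_digraph_def fin_digraph_axioms_def)
qed

text \<open>
  Within a cycle take an arc. In a connected sum, two vertices of the same summand are separated by
  a cut of this summand, where the complement of the cut is used if the cut contains the attaching
  vertex. If only one of the two vertices lies in a summand, separate it from the attaching vertex.
\<close>

lemma sum_of_cycles_separate:
  assumes "sum_of_cycles R" and "u \<in> verts R" and "w \<in> verts R" and "u \<noteq> w"
  shows "\<exists>X. two_arrow_cut R X \<and> u \<in> X \<and> w \<notin> X"
  using assms
proof (induction arbitrary: u w)
  case (cycle i R)
  then obtain f where f: "pre_digraph.digraph_isomorphism (cyclic_quiver i) f"
    "R = app_iso f (cyclic_quiver i)" by (auto simp: digraph_iso_def)
  then have inj: "inj_on (iso_verts f) {..i}"
    by (simp add: pre_digraph.digraph_isomorphism_def cyclic_quiver_def)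
  obtain p q where pq: "u = iso_verts f p" "w = iso_verts f q" "p \<le> i" "q \<le> i"
    using cycle(2,3) f(2) by (auto simp: cyclic_quiver_def)
  show ?case
  proof (cases "p < q")
    case True
    have "two_arrow_cut R (iso_verts f ` {p..<q})"
      unfolding f(2) using f(1) cyclic_quiver_cut[OF True pq(4)] by (rule two_arrow_cut_app_iso)
    moreover have "w \<notin> iso_verts f ` {p..<q}"
      using pq inj_onD[OF inj, of q] by force
    ultimately show ?thesis using pq True by auto
  next
    case False
    with pq cycle(4) have qp: "q < p" by (metis linorder_neqE_nat)
    have "two_arrow_cut R (iso_verts f ` {q..<p})"
      unfolding f(2) using f(1) cyclic_quiver_cut[OF qp pq(3)] by (rule two_arrow_cut_app_iso)
    from two_arrow_cut_complement[OF this] moreover have "u \<notin> iso_verts f ` {q..<p}"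
      using pq inj_onD[OF inj, of p] by force
    ultimately show ?thesis using pq qp cycle(2) by auto
  qed
next
  case (sum R S Q v)
  have sym: "connected_sum Q S R v"
    using sum.hyps(3) by (auto simp: connected_sum_def)
  have same: "\<exists>X. two_arrow_cut Q X \<and> u \<in> X \<and> w \<notin> X"
    if cs: "connected_sum Q R' S' v"
      and IH: "\<And>u w. u \<in> verts R' \<Longrightarrow> w \<in> verts R' \<Longrightarrow> u \<noteq> w \<Longrightarrow> \<exists>X. two_arrow_cut R' X \<and> u \<in> X \<and> w \<notin> X"
      and u: "u \<in> verts R'" and w: "w \<in> verts R'"
    for R' S'
  proof -
    obtain X where X: "two_arrow_cut R' X" "u \<in> X" "w \<notin> X" using IH[OF u w sum.prems(3)] by blast
    show ?thesis
    proof (cases "v \<in> X")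
      case False
      then show ?thesis using two_arrow_cut_connected_sum[OF cs X(1)] X by blast
    next
      case True
      have "two_arrow_cut Q (verts R' - X)"
        using two_arrow_cut_connected_sum[OF cs two_arrow_cut_complement[OF X(1)]] True by simp
      from two_arrow_cut_complement[OF this] show ?thesis
        using X w sum.prems by blast
    qed
  qed
  have apart: "\<exists>X. two_arrow_cut Q X \<and> u \<in> X \<and> w \<notin> X"
    if cs: "connected_sum Q R' S' v"
      and IH: "\<And>u w. u \<in> verts R' \<Longrightarrow> w \<in> verts R' \<Longrightarrow> u \<noteq> w \<Longrightarrow> \<exists>X. two_arrow_cut R' X \<and> u \<in> X \<and> w \<notin> X"
      and u: "u \<in> verts R'" "u \<notin> verts S'" and w: "w \<in> verts S'"
    for R' S'
  proof -
    have v: "v \<in> verts R'" "u \<noteq> v" and int: "verts R' \<inter> verts S' = {v}"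
      using cs u by (auto simp: connected_sum_def)
    obtain X where X: "two_arrow_cut R' X" "u \<in> X" "v \<notin> X" using IH[OF u(1) v] by blast
    then have "w \<notin> X" using int w by (auto simp: two_arrow_cut_def)
    then show ?thesis using two_arrow_cut_connected_sum[OF cs X(1)] X by blast
  qed
  have "verts Q = verts R \<union> verts S" using sum.hyps(3) by (simp add: connected_sum_def)
  then show ?case
    using same[OF sum.hyps(3) sum.IH(1)] same[OF sym sum.IH(2)]
      apart[OF sum.hyps(3) sum.IH(1)] apart[OF sym sum.IH(2)] sum.prems by blast
qed

section \<open>The summands of a local setting have disjoint supports\<close>

lemma card_arrows_sum:
  assumes "fin_digraph R" and "finite X" and "finite Y"
  shows "card (arrows R X Y) = (\<Sum>i\<in>X. \<Sum>j\<in>Y. card (arrows R {i} {j}))"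
proof -
  interpret fin_digraph R by fact
  have "arrows R X Y = (\<Union>p\<in>X \<times> Y. arrows R {fst p} {snd p})"
    by (auto simp: arrows_def)
  also have "card \<dots> = (\<Sum>p\<in>X \<times> Y. card (arrows R {fst p} {snd p}))"
    using assms by (intro card_UN_disjoint) (auto simp: arrows_def)
  also have "\<dots> = (\<Sum>i\<in>X. \<Sum>j\<in>Y. card (arrows R {i} {j}))"
    by (simp add: sum.cartesian_product split_beta)
  finally show ?thesis .
qed

lemma euler_form_blocks:
  assumes "fin_digraph R" and "X \<subseteq> verts R" and "Y \<subseteq> verts R" and "X \<inter> Y = {}"
    and form: "\<And>u w. u \<in> verts R \<Longrightarrow> w \<in> verts R \<Longrightarrow>
      euler_form Q (B u) (B w) = (if u = w then 1 else 0) - int (card (arrows R {u} {w}))"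
  shows "euler_form Q (\<lambda>x. \<Sum>u\<in>X. B u x) (\<lambda>x. \<Sum>w\<in>Y. B w x) = - int (card (arrows R X Y))"
proof -
  interpret fin_digraph R by fact
  have fin: "finite X" "finite Y" using assms(2,3) finite_subset[OF _ finite_verts] by auto
  have "euler_form Q (\<lambda>x. \<Sum>u\<in>X. B u x) (\<lambda>x. \<Sum>w\<in>Y. B w x)
      = (\<Sum>u\<in>X. \<Sum>w\<in>Y. euler_form Q (B u) (B w))"
    by (simp add: euler_form_sum_left euler_form_sum_right)
  also have "\<dots> = (\<Sum>u\<in>X. \<Sum>w\<in>Y. - int (card (arrows R {u} {w})))"
  proof (intro sum.cong refl)
    fix u w assume "u \<in> X" "w \<in> Y"
    then have "u \<in> verts R" "w \<in> verts R" "u \<noteq> w" using assms(2,3,4) by auto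
    then show "euler_form Q (B u) (B w) = - int (card (arrows R {u} {w}))"
      using form by simp
  qed
  finally show ?thesis
    by (simp add: card_arrows_sum[OF assms(1) fin] sum_negf)
qed

text \<open>
  Each summand \<open>B u\<close> contributes a nonpositive amount unless \<open>B u\<close> is \<open>unit_dim v\<close>. In that case the
  form is the one with \<open>\<alpha>\<close>, which is at most \<open>-1\<close> by reducedness, minus the one with the
  complementary block; the latter is minus the number of arrows of \<open>R\<close> from \<open>u\<close> across the cut,
  hence at least \<open>-1\<close>.
\<close>

lemma block_unit_nonpos:
  assumes red: "reduced_setting Q \<alpha>" and R: "fin_digraph R"
    and split: "\<And>x. x \<in> verts Q \<Longrightarrow> \<alpha> x = (\<Sum>u\<in>verts R. B u x)"
    and form: "\<And>u w. u \<in> verts R \<Longrightarrow> w \<in> verts R \<Longrightarrow>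
      euler_form Q (B u) (B w) = (if u = w then 1 else 0) - int (card (arrows R {u} {w}))"
    and unit: "\<And>u v. u \<in> verts R \<Longrightarrow> v \<in> verts Q \<Longrightarrow>
      euler_form Q (unit_dim v) (B u) \<le> 0 \<or> (\<forall>x\<in>verts Q. B u x = unit_dim v x)"
    and X: "two_arrow_cut R X" and v: "v \<in> verts Q"
  shows "euler_form Q (unit_dim v) (\<lambda>x. \<Sum>u\<in>X. B u x) \<le> 0"
proof (cases "\<exists>u\<in>X. \<forall>x\<in>verts Q. B u x = unit_dim v x")
  case False
  then show ?thesis
    using unit v X by (auto simp: euler_form_sum_right two_arrow_cut_def intro!: sum_nonpos)
next
  case True
  interpret fin_digraph R by fact
  let ?Y = "verts R - X"
  have XR: "X \<subseteq> verts R" and one: "card (arrows R X ?Y) = 1"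
    using X by (auto simp: two_arrow_cut_def)
  have Q: "fin_digraph Q" using red by (simp add: reduced_setting_def quiver_setting_def)
  obtain u where u: "u \<in> X" and Bu: "\<And>x. x \<in> verts Q \<Longrightarrow> B u x = unit_dim v x"
    using True by blast
  have "euler_form Q (unit_dim v) (\<lambda>x. \<Sum>w\<in>?Y. B w x) = euler_form Q (B u) (\<lambda>x. \<Sum>w\<in>?Y. B w x)"
    by (rule euler_form_cong[OF Q]) (simp_all add: Bu)
  also have "\<dots> = - int (card (arrows R {u} ?Y))"
    using euler_form_blocks[OF R, of "{u}" ?Y, OF _ _ _ form] u XR by auto
  also have "\<dots> \<ge> - int (card (arrows R X ?Y))"
  proof -
    have "card (arrows R {u} ?Y) \<le> card (arrows R X ?Y)"
      using u by (intro card_mono) (auto simp: arrows_def)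
    then show ?thesis by simp
  qed
  finally have Y: "-1 \<le> euler_form Q (unit_dim v) (\<lambda>x. \<Sum>w\<in>?Y. B w x)"
    using one by simp
  have "euler_form Q (unit_dim v) \<alpha>
      = euler_form Q (unit_dim v) (\<lambda>x. (\<Sum>w\<in>X. B w x) + (\<Sum>w\<in>?Y. B w x))"
    using split XR by (intro euler_form_cong[OF Q]) (auto simp: sum.subset_diff[of X "verts R"])
  then show ?thesis
    using Y reduced_unit_bound(1)[OF red v] by (simp add: euler_form_add_right)
qed

lemma summand_supports_disjoint:
  assumes red: "reduced_setting Q \<alpha>" and soc: "sum_of_cycles R"
    and split: "\<And>x. x \<in> verts Q \<Longrightarrow> \<alpha> x = (\<Sum>u\<in>verts R. B u x)"
    and form: "\<And>u w. u \<in> verts R \<Longrightarrow> w \<in> verts R \<Longrightarrow>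
      euler_form Q (B u) (B w) = (if u = w then 1 else 0) - int (card (arrows R {u} {w}))"
    and unit: "\<And>u v. u \<in> verts R \<Longrightarrow> v \<in> verts Q \<Longrightarrow>
      euler_form Q (unit_dim v) (B u) \<le> 0 \<or> (\<forall>x\<in>verts Q. B u x = unit_dim v x)"
    and uw: "u \<in> verts R" "w \<in> verts R" "u \<noteq> w" and x: "x \<in> verts Q"
  shows "B u x = 0 \<or> B w x = 0"
proof -
  have R: "fin_digraph R" using soc by (rule sum_of_cycles_fin_digraph)
  interpret fin_digraph R by fact
  obtain X where X: "two_arrow_cut R X" "u \<in> X" "w \<notin> X"
    using sum_of_cycles_separate[OF soc uw] by blast
  let ?Y = "verts R - X"
  have XR: "X \<subseteq> verts R" and one: "card (arrows R X ?Y) = 1" "card (arrows R ?Y X) = 1"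
    using X(1) by (auto simp: two_arrow_cut_def)
  have fin: "finite X" using XR finite_subset[OF _ finite_verts] by auto
  have "(\<Sum>i\<in>X. B i x) = 0 \<or> (\<Sum>i\<in>?Y. B i x) = 0"
  proof (rule complementary_blocks_disjoint[OF red, where \<beta> = "\<lambda>x. \<Sum>i\<in>X. B i x" and \<gamma> = "\<lambda>x. \<Sum>i\<in>?Y. B i x"])
    show "\<alpha> y = (\<Sum>i\<in>X. B i y) + (\<Sum>i\<in>?Y. B i y)" if "y \<in> verts Q" for y
      using split[OF that] XR by (simp add: sum.subset_diff[of X "verts R"])
    show "euler_form Q (\<lambda>x. \<Sum>i\<in>X. B i x) (\<lambda>x. \<Sum>i\<in>?Y. B i x) = -1"
      using euler_form_blocks[OF R XR _ _ form, of ?Y] one by simp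
    show "euler_form Q (\<lambda>x. \<Sum>i\<in>?Y. B i x) (\<lambda>x. \<Sum>i\<in>X. B i x) = -1"
      using euler_form_blocks[OF R _ XR _ form, of ?Y] one by auto
    show "euler_form Q (unit_dim y) (\<lambda>x. \<Sum>i\<in>X. B i x) \<le> 0" if "y \<in> verts Q" for y
      using block_unit_nonpos[OF red R split form unit X(1) that] by blast
    show "euler_form Q (unit_dim y) (\<lambda>x. \<Sum>i\<in>?Y. B i x) \<le> 0" if "y \<in> verts Q" for y
      using block_unit_nonpos[OF red R split form unit two_arrow_cut_complement[OF X(1)] that] by blast
  qed (fact x)
  then show ?thesis using X uw fin by auto
qed

lemma sum_of_cycles_card_arrows_le_1:
  assumes "sum_of_cycles R" and "u \<in> verts R" and "w \<in> verts R" and "u \<noteq> w"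
  shows "card (arrows R {u} {w}) \<le> 1"
proof -
  interpret fin_digraph R using assms(1) by (rule sum_of_cycles_fin_digraph)
  obtain X where X: "two_arrow_cut R X" "u \<in> X" "w \<notin> X"
    using sum_of_cycles_separate[OF assms] by blast
  then have "card (arrows R {u} {w}) \<le> card (arrows R X (verts R - X))"
    using assms(3) by (intro card_mono) (auto simp: arrows_def)
  then show ?thesis using X by (simp add: two_arrow_cut_def)
qed

section \<open>Restriction and extension of simple representations\<close>

definition restrict_dim :: "'v set \<Rightarrow> ('v \<Rightarrow> nat) \<Rightarrow> 'v \<Rightarrow> nat" where
  "restrict_dim U \<alpha> = (\<lambda>x. if x \<in> U then \<alpha> x else 0)"

lemma euler_form_restrict_dim:
  assumes "fin_digraph Q" and "U \<subseteq> verts Q"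
  shows "euler_form Q (restrict_dim U \<alpha>) (restrict_dim W \<alpha>)
    = (\<Sum>x\<in>U \<inter> W. int (\<alpha> x) * int (\<alpha> x)) - (\<Sum>e\<in>arrows Q U W. int (\<alpha> (tail Q e)) * int (\<alpha> (head Q e)))"
proof -
  interpret fin_digraph Q by fact
  have "(\<Sum>x\<in>verts Q. int (restrict_dim U \<alpha> x) * int (restrict_dim W \<alpha> x)) = (\<Sum>x\<in>U \<inter> W. int (\<alpha> x) * int (\<alpha> x))"
    by (rule sum.mono_neutral_cong_right) (use assms in \<open>auto simp: restrict_dim_def\<close>)
  moreover have "(\<Sum>e\<in>arcs Q. int (restrict_dim U \<alpha> (tail Q e)) * int (restrict_dim W \<alpha> (head Q e)))
      = (\<Sum>e\<in>arrows Q U W. int (\<alpha> (tail Q e)) * int (\<alpha> (head Q e)))"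
    by (rule sum.mono_neutral_cong_right) (auto simp: restrict_dim_def arrows_def)
  ultimately show ?thesis by (simp add: euler_form_def)
qed

lemma euler_form_induce_subgraph:
  assumes "fin_digraph Q" and "U \<subseteq> verts Q"
  shows "euler_form (induce_subgraph Q U) \<alpha> \<alpha> = euler_form Q (restrict_dim U \<alpha>) (restrict_dim U \<alpha>)"
  unfolding euler_form_restrict_dim[OF assms]
  by (simp add: euler_form_def induce_subgraph_def arrows_def)

text \<open>
  Outside the support all spaces are zero, so a family of subspaces on the support extends uniquely
  by zero spaces and the subrepresentations correspond.
\<close>

lemma simple_rep_restrict_support:
  fixes M :: "('v, 'a, 'k::field) quiver_rep"
  assumes "fin_digraph Q" and simple: "simple_rep Q M"
  shows "simple_rep (induce_subgraph Q {x \<in> verts Q. rep_dim M x \<noteq> 0}) M"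
proof -
  interpret fin_digraph Q by fact
  define U where "U = {x \<in> verts Q. rep_dim M x \<noteq> 0}"
  let ?P = "induce_subgraph Q U"
  have mat: "rep_mat M e \<in> carrier_mat (rep_dim M (head Q e)) (rep_dim M (tail Q e))"
    if "e \<in> arcs Q" for e
    using simple that by (auto simp: simple_rep_def is_rep_def)
  have "(\<forall>v\<in>U. W v = {0\<^sub>v (rep_dim M v)}) \<or> (\<forall>v\<in>U. W v = carrier_vec (rep_dim M v))"
    if W: "subrep ?P M W" for W
  proof -
    define W' where "W' x = (if x \<in> U then W x else {0\<^sub>v (rep_dim M x)})" for x
    have sub: "W x \<subseteq> carrier_vec (rep_dim M x)" "0\<^sub>v (rep_dim M x) \<in> W x" if "x \<in> U" for x
      using W that by (auto simp: subrep_def subspace_module_vec_iff)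
    have "subrep Q M W'"
      unfolding subrep_def
    proof (intro conjI ballI)
      fix x assume "x \<in> verts Q"
      show "VectorSpace.subspace class_ring (W' x) (module_vec TYPE('k) (rep_dim M x))"
      proof (cases "x \<in> U")
        case True
        then show ?thesis using W by (simp add: subrep_def W'_def)
      qed (simp add: W'_def subspace_module_vec_iff smult_vec_zero)
    next
      fix e y assume e: "e \<in> arcs Q" and y: "y \<in> W' (tail Q e)"
      show "rep_mat M e *\<^sub>v y \<in> W' (head Q e)"
      proof (cases "tail Q e \<in> U \<and> head Q e \<in> U")
        case True
        then show ?thesis using W e y by (auto simp: subrep_def W'_def induce_subgraph_def)
      next
        case False
        have "rep_mat M e *\<^sub>v y = 0\<^sub>v (rep_dim M (head Q e))"
        proof (cases "tail Q e \<in> U")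
          case True
          then have "rep_dim M (head Q e) = 0" using False e by (auto simp: U_def)
          then show ?thesis using mat[OF e] by auto
        next
          case False
          then show ?thesis using y mult_mat_vec_zero[OF mat[OF e]] by (simp add: W'_def)
        qed
        then show ?thesis using sub(2) by (simp add: W'_def)
      qed
    qed
    then have "(\<forall>x\<in>verts Q. W' x = {0\<^sub>v (rep_dim M x)}) \<or> (\<forall>x\<in>verts Q. W' x = carrier_vec (rep_dim M x))"
      using simple by (simp add: simple_rep_def)
    then show ?thesis by (auto simp: W'_def U_def)
  qed
  then show ?thesis
    using simple unfolding U_def[symmetric] simple_rep_def is_rep_def
    by (auto simp: induce_subgraph_def) (auto simp: U_def)
qed

definition extend_by_zero ::
  "('v, 'a) pre_digraph \<Rightarrow> 'v set \<Rightarrow> ('v, 'a, 'k::field) quiver_rep \<Rightarrow> ('v, 'a, 'k) quiver_rep" where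
  "extend_by_zero Q U M =
     (let d = restrict_dim U (rep_dim M)
      in \<lparr>rep_dim = d,
          rep_mat = (\<lambda>e. if e \<in> arrows Q U U then rep_mat M e else 0\<^sub>m (d (head Q e)) (d (tail Q e)))\<rparr>)"

lemma simple_rep_extend_by_zero:
  fixes M :: "('v, 'a, 'k::field) quiver_rep"
  assumes "U \<subseteq> verts Q" and simple: "simple_rep (induce_subgraph Q U) M"
  shows "simple_rep Q (extend_by_zero Q U M)"
proof -
  let ?P = "induce_subgraph Q U" and ?N = "extend_by_zero Q U M"
  have arcs: "arcs ?P = arrows Q U U" by (auto simp: induce_subgraph_def arrows_def)
  have dim: "rep_dim ?N x = (if x \<in> U then rep_dim M x else 0)" for x
    by (simp add: extend_by_zero_def Let_def restrict_dim_def)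
  have matU: "rep_mat ?N e = rep_mat M e" if "e \<in> arrows Q U U" for e
    using that by (simp add: extend_by_zero_def Let_def)
  have rep: "is_rep Q ?N"
    using simple arcs
    by (auto simp: simple_rep_def is_rep_def dim extend_by_zero_def Let_def restrict_dim_def arrows_def
        induce_subgraph_def)
  have "(\<forall>x\<in>verts Q. W x = {0\<^sub>v (rep_dim ?N x)}) \<or> (\<forall>x\<in>verts Q. W x = carrier_vec (rep_dim ?N x))"
    if W: "subrep Q ?N W" for W
  proof -
    have "VectorSpace.subspace class_ring (W x) (module_vec TYPE('k) (rep_dim M x))" if "x \<in> U" for x
      using W that assms(1) dim[of x] by (force simp: subrep_def)
    moreover have "rep_mat M e *\<^sub>v y \<in> W (head Q e)" if "e \<in> arrows Q U U" "y \<in> W (tail Q e)" for e y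
      using W that matU[OF that(1)] by (force simp: subrep_def arrows_def)
    ultimately have "subrep ?P M W"
      unfolding subrep_def arcs by (simp add: induce_subgraph_def)
    then have or: "(\<forall>x\<in>U. W x = {0\<^sub>v (rep_dim M x)}) \<or> (\<forall>x\<in>U. W x = carrier_vec (rep_dim M x))"
      using simple by (simp add: simple_rep_def)
    have "W x = {0\<^sub>v 0}" "carrier_vec 0 = {0\<^sub>v 0 :: 'k vec}" if "x \<in> verts Q" "x \<notin> U" for x
    proof -
      show c0: "carrier_vec 0 = {0\<^sub>v 0 :: 'k vec}" by auto
      show "W x = {0\<^sub>v 0}"
      proof -
        have "W x \<subseteq> carrier_vec 0" "0\<^sub>v 0 \<in> W x"
          using W that dim[of x] unfolding subrep_def subspace_module_vec_iff by metis+
        then show ?thesis unfolding c0 by blast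
      qed
    qed
    then show ?thesis using or dim by auto
  qed
  then show ?thesis
    using rep simple assms(1) dim by (fastforce simp: simple_rep_def)
qed

section \<open>Local quiver settings\<close>

lemma rep_dim_rep_sum:
  "rep_dim (rep_sum (concat (map (\<lambda>i. replicate (a i) (S i)) [0..<k]))) x = (\<Sum>i<k. a i * rep_dim (S i) x)"
  by (induction k) (simp_all add: rep_sum_def sum_list_replicate)

lemma is_rep_rep_sum:
  assumes "\<And>M. M \<in> set Ms \<Longrightarrow> is_rep Q M"
  shows "is_rep Q (rep_sum Ms)"
proof -
  have "(\<Sum>M\<leftarrow>Ms. dim_row (rep_mat M e)) = (\<Sum>M\<leftarrow>Ms. rep_dim M (head Q e))"
    "(\<Sum>M\<leftarrow>Ms. dim_col (rep_mat M e)) = (\<Sum>M\<leftarrow>Ms. rep_dim M (tail Q e))" if "e \<in> arcs Q" for e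
    using assms that
    by (auto simp: is_rep_def intro!: arg_cong[where f = sum_list] map_cong)
  then show ?thesis
    by (auto simp: is_rep_def rep_sum_def dim_diag_block_mat comp_def intro!: carrier_matI)
qed

lemma rep_iso_refl:
  fixes M :: "('v, 'a, 'k::field) quiver_rep"
  assumes "fin_digraph Q" and "is_rep Q M"
  shows "rep_iso Q M M"
proof -
  interpret fin_digraph Q by fact
  have "invertible_mat (1\<^sub>m n :: 'k mat)" for n
    by (auto simp: invertible_mat_def inverts_mat_def intro!: exI[of _ "1\<^sub>m n"])
  then show ?thesis
    using assms(2) unfolding rep_iso_def is_rep_def
    by (intro conjI exI[of _ "\<lambda>v. 1\<^sub>m (rep_dim M v)"]) auto
qed

text \<open>
  A sum of positive integers that is at most \<open>1\<close> has at most one term, equal to \<open>1\<close>.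
\<close>

lemma sum_of_pos_int_eq_card:
  fixes g :: "'e \<Rightarrow> int"
  assumes "finite A" and "\<And>e. e \<in> A \<Longrightarrow> 1 \<le> g e" and "(\<Sum>e\<in>A. g e) \<le> 1"
  shows "(\<forall>e\<in>A. g e = 1) \<and> (\<Sum>e\<in>A. g e) = int (card A)"
proof -
  have "g e = 1" if "e \<in> A" for e
  proof -
    have "0 \<le> (\<Sum>e'\<in>A - {e}. g e')" using assms(2) by (force intro: sum_nonneg)
    then show ?thesis using assms that by (simp add: sum.remove[OF assms(1) that]) (force intro: antisym)
  qed
  then show ?thesis by simp
qed

definition simple_partition ::
  "'k::field itself \<Rightarrow> ('v, 'a) pre_digraph \<Rightarrow> ('v \<Rightarrow> nat) \<Rightarrow>
     ('w, 'b) pre_digraph \<Rightarrow> ('w \<Rightarrow> 'v set) \<Rightarrow> bool" where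
  "simple_partition K Q \<alpha> R V \<longleftrightarrow>
     (\<Union>u\<in>verts R. V u) = verts Q \<and>
     disjoint_family_on V (verts R) \<and>
     (\<forall>u\<in>verts R. V u \<noteq> {}) \<and>
     (\<forall>u\<in>verts R.
        simple_setting K (induce_subgraph Q (V u)) \<alpha> \<and>
        int (card (loops R u)) = 1 - euler_form (induce_subgraph Q (V u)) \<alpha> \<alpha>) \<and>
     (\<forall>u\<in>verts R. \<forall>w\<in>verts R. u \<noteq> w \<longrightarrow>
        card (arrows Q (V u) (V w)) = card (arrows R {u} {w}) \<and>
        (\<forall>e\<in>arrows Q (V u) (V w). \<alpha> (tail Q e) = 1 \<and> \<alpha> (head Q e) = 1))"

text \<open>
  The class of \<open>u\<close> is the support of the summand attached to \<open>u\<close>. Since the supports are disjoint,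
  this summand has the dimensions of \<open>\<alpha>\<close> there.
\<close>

lemma partition_of_local_setting:
  fixes K :: "'k::field itself" and \<alpha> :: "'v \<Rightarrow> nat" and R :: "('w, 'b) pre_digraph"
  assumes red: "reduced_setting Q \<alpha>" and soc: "sum_of_cycles R"
    and loc: "local_setting K Q \<alpha> R (\<lambda>_. 1)"
  shows "\<exists>V. simple_partition K Q \<alpha> R V"
proof -
  have Q: "fin_digraph Q" and pos: "\<And>x. x \<in> verts Q \<Longrightarrow> 1 \<le> \<alpha> x"
    using red by (auto simp: reduced_setting_def quiver_setting_def)
  interpret Q: fin_digraph Q by fact
  interpret R: fin_digraph R using soc by (rule sum_of_cycles_fin_digraph)
  obtain M :: "('v, 'a, 'k) quiver_rep" and k S a \<phi>
    where M: "\<forall>x\<in>verts Q. rep_dim M x = \<alpha> x"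
      and dec: "semisimple_decomposition Q M k S a"
      and \<phi>: "bij_betw \<phi> {..<k} (verts R)"
      and a: "\<forall>i<k. 1 = a i"
      and card: "\<forall>i<k. \<forall>j<k. int (card (arrows R {\<phi> i} {\<phi> j})) =
         (if i = j then 1 else 0) - euler_form Q (rep_dim (S i)) (rep_dim (S j))"
    using loc unfolding local_setting_def by blast
  define \<psi> where "\<psi> = the_inv_into {..<k} \<phi>"
  have \<psi>: "\<psi> u < k" "\<phi> (\<psi> u) = u" if "u \<in> verts R" for u
    using \<phi> that the_inv_into_into[of \<phi> "{..<k}" u "{..<k}"] f_the_inv_into_f[of \<phi> "{..<k}" u]
    by (auto simp: \<psi>_def bij_betw_def)
  have \<psi>\<phi>: "\<psi> (\<phi> i) = i" if "i < k" for i
    using \<phi> that by (simp add: \<psi>_def bij_betw_def the_inv_into_f_f)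
  define B where "B u = rep_dim (S (\<psi> u))" for u
  have simple: "simple_rep Q (S (\<psi> u))" if "u \<in> verts R" for u
    using dec \<psi>(1)[OF that] by (auto simp: semisimple_decomposition_def)
  have form: "euler_form Q (B u) (B w) = (if u = w then 1 else 0) - int (card (arrows R {u} {w}))"
    if "u \<in> verts R" "w \<in> verts R" for u w
  proof -
    have "\<psi> u = \<psi> w \<longleftrightarrow> u = w" using \<psi>(2) that by metis
    with card[rule_format, OF \<psi>(1)[OF that(1)] \<psi>(1)[OF that(2)]] show ?thesis
      unfolding B_def \<psi>(2)[OF that(1)] \<psi>(2)[OF that(2)] by simp
  qed
  have split: "\<alpha> x = (\<Sum>u\<in>verts R. B u x)" if "x \<in> verts Q" for x
  proof -
    have "\<alpha> x = rep_dim (rep_sum (concat (map (\<lambda>i. replicate (a i) (S i)) [0..<k]))) x"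
      using dec M that by (simp add: semisimple_decomposition_def rep_iso_def)
    also have "\<dots> = (\<Sum>i<k. B (\<phi> i) x)"
      unfolding rep_dim_rep_sum by (intro sum.cong) (simp_all add: a[rule_format, symmetric] B_def \<psi>\<phi>)
    also have "\<dots> = (\<Sum>u\<in>verts R. B u x)"
      using \<phi> by (rule sum.reindex_bij_betw)
    finally show ?thesis .
  qed
  have unit: "euler_form Q (unit_dim v) (B u) \<le> 0 \<or> (\<forall>x\<in>verts Q. B u x = unit_dim v x)"
    if "u \<in> verts R" "v \<in> verts Q" for u v
    using simple_rep_unit_form[OF Q simple[OF that(1)] that(2)] by (simp add: B_def)
  have disj: "B u x = 0 \<or> B w x = 0"
    if "u \<in> verts R" "w \<in> verts R" "u \<noteq> w" "x \<in> verts Q" for u w x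
    by (rule summand_supports_disjoint[where B = B and u = u and w = w and R = R, OF red soc])
      (erule split | erule (1) form | erule (1) unit | rule that)+
  define V where "V u = {x \<in> verts Q. B u x \<noteq> 0}" for u
  have VQ: "V u \<subseteq> verts Q" for u by (auto simp: V_def)
  have B: "B u x = \<alpha> x" if "u \<in> verts R" "x \<in> V u" for u x
  proof -
    have "(\<Sum>w\<in>verts R - {u}. B w x) = 0"
    proof (intro sum.neutral ballI)
      fix w assume "w \<in> verts R - {u}"
      then show "B w x = 0" using disj[of u w x] that by (auto simp: V_def)
    qed
    then show ?thesis
      using split[of x] that sum.remove[OF R.finite_verts that(1), of "\<lambda>w. B w x"] by (simp add: V_def)
  qed
  have Bform: "euler_form Q (restrict_dim (V u) \<alpha>) (restrict_dim (V w) \<alpha>) = euler_form Q (B u) (B w)"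
    if "u \<in> verts R" "w \<in> verts R" for u w
    using B that by (intro euler_form_cong[OF Q]) (auto simp: restrict_dim_def V_def)
  have dis: "V u \<inter> V w = {}" if "u \<in> verts R" "w \<in> verts R" "u \<noteq> w" for u w
  proof (rule equals0I)
    fix x assume "x \<in> V u \<inter> V w"
    then show False using disj[OF that, of x] by (simp add: V_def)
  qed
  show ?thesis
  unfolding simple_partition_def
  proof (intro exI[of _ V] conjI ballI impI)
    show "(\<Union>u\<in>verts R. V u) = verts Q"
    proof
      show "verts Q \<subseteq> (\<Union>u\<in>verts R. V u)"
      proof
        fix x assume x: "x \<in> verts Q"
        have "\<exists>u\<in>verts R. B u x \<noteq> 0"
        proof (rule ccontr)
          assume "\<not> ?thesis"
          then have "(\<Sum>u\<in>verts R. B u x) = 0" by (intro sum.neutral) blast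
          then show False using split[OF x] pos[OF x] by linarith
        qed
        then obtain u where "u \<in> verts R" "B u x \<noteq> 0" by blast
        then show "x \<in> (\<Union>u\<in>verts R. V u)" using x by (auto simp: V_def)
      qed
    qed (use VQ in blast)
    show "disjoint_family_on V (verts R)"
      using dis by (simp add: disjoint_family_on_def)
  next
    fix u assume u: "u \<in> verts R"
    show "V u \<noteq> {}"
      using simple[OF u] by (auto simp: V_def B_def simple_rep_def)
    show "simple_setting K (induce_subgraph Q (V u)) \<alpha>"
      unfolding simple_setting_def
    proof (intro exI[of _ "S (\<psi> u)"] conjI ballI)
      show "simple_rep (induce_subgraph Q (V u)) (S (\<psi> u))"
        using simple_rep_restrict_support[OF Q simple[OF u]] by (simp add: V_def B_def)
      show "rep_dim (S (\<psi> u)) x = \<alpha> x" if "x \<in> verts (induce_subgraph Q (V u))" for x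
        using B[OF u] that by (simp add: B_def)
    qed
    show "int (card (loops R u)) = 1 - euler_form (induce_subgraph Q (V u)) \<alpha> \<alpha>"
      using form[OF u u] Bform[OF u u] euler_form_induce_subgraph[OF Q VQ] by (simp add: loops_def)
  next
    fix u w assume uw: "u \<in> verts R" "w \<in> verts R" "u \<noteq> w"
    let ?A = "arrows Q (V u) (V w)"
    have sum: "(\<Sum>e\<in>?A. int (\<alpha> (tail Q e)) * int (\<alpha> (head Q e))) = int (card (arrows R {u} {w}))"
      using form[OF uw(1,2)] Bform[OF uw(1,2)] euler_form_restrict_dim[OF Q VQ, of u \<alpha> "V w"] dis[OF uw] uw(3)
      by simp
    have ge1: "1 \<le> int (\<alpha> (tail Q e)) * int (\<alpha> (head Q e))" if "e \<in> ?A" for e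
    proof -
      have "1 \<le> \<alpha> (tail Q e)" "1 \<le> \<alpha> (head Q e)" using that pos by (auto simp: arrows_def)
      then show ?thesis by (metis mult_le_mono nat_mult_1 of_nat_1 of_nat_le_iff of_nat_mult)
    qed
    have "finite ?A" by (simp add: arrows_def)
    moreover have "(\<Sum>e\<in>?A. int (\<alpha> (tail Q e)) * int (\<alpha> (head Q e))) \<le> 1"
      unfolding sum using sum_of_cycles_card_arrows_le_1[OF soc uw] by simp
    ultimately have *: "(\<forall>e\<in>?A. int (\<alpha> (tail Q e)) * int (\<alpha> (head Q e)) = 1) \<and>
      (\<Sum>e\<in>?A. int (\<alpha> (tail Q e)) * int (\<alpha> (head Q e))) = int (card ?A)"
      using ge1 by (intro sum_of_pos_int_eq_card)
    then show "card ?A = card (arrows R {u} {w})" unfolding sum by linarith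
    fix e assume "e \<in> ?A"
    with * have "int (\<alpha> (tail Q e)) * int (\<alpha> (head Q e)) = 1" by blast
    then show "\<alpha> (tail Q e) = 1" "\<alpha> (head Q e) = 1" by (auto simp: zmult_eq_1_iff)
  qed
qed

text \<open>
  The summands are the simple representations of the classes, extended by zero. They are pairwise
  non-isomorphic because their supports are disjoint and nonempty. Between different classes all
  arrows join vertices of dimension \<open>1\<close>, so that minus the Euler form counts arrows.
\<close>

lemma local_setting_of_partition:
  fixes K :: "'k::field itself" and \<alpha> :: "'v \<Rightarrow> nat" and V :: "'w \<Rightarrow> 'v set" and R :: "('w, 'b) pre_digraph"
  assumes "quiver_setting Q \<alpha>" and R: "fin_digraph R"
    and partition: "simple_partition K Q \<alpha> R V"
  shows "local_setting K Q \<alpha> R (\<lambda>_. 1)"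
proof -
  note parts = partition[unfolded simple_partition_def]
  have cover: "(\<Union>u\<in>verts R. V u) = verts Q" and disj: "disjoint_family_on V (verts R)"
    using parts by simp_all
  have ne: "V u \<noteq> {}" and simple: "simple_setting K (induce_subgraph Q (V u)) \<alpha>"
    and loops: "int (card (loops R u)) = 1 - euler_form (induce_subgraph Q (V u)) \<alpha> \<alpha>"
    if "u \<in> verts R" for u
    using parts that by simp_all
  have arrows: "card (arrows Q (V u) (V w)) = card (arrows R {u} {w})"
    and dim1: "\<And>e. e \<in> arrows Q (V u) (V w) \<Longrightarrow> \<alpha> (tail Q e) = 1 \<and> \<alpha> (head Q e) = 1"
    if "u \<in> verts R" "w \<in> verts R" "u \<noteq> w" for u w
    using parts that by simp_all
  have Q: "fin_digraph Q" and pos: "\<And>x. x \<in> verts Q \<Longrightarrow> 1 \<le> \<alpha> x"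
    using assms(1) by (auto simp: quiver_setting_def)
  interpret R: fin_digraph R by fact
  have VQ: "V u \<subseteq> verts Q" if "u \<in> verts R" for u using cover that by blast
  have "\<forall>u\<in>verts R. \<exists>N :: ('v, 'a, 'k) quiver_rep.
      (\<forall>x\<in>V u. rep_dim N x = \<alpha> x) \<and> simple_rep (induce_subgraph Q (V u)) N"
    using simple by (simp add: simple_setting_def)
  then obtain N :: "'w \<Rightarrow> ('v, 'a, 'k) quiver_rep"
    where N: "\<And>u x. u \<in> verts R \<Longrightarrow> x \<in> V u \<Longrightarrow> rep_dim (N u) x = \<alpha> x"
      "\<And>u. u \<in> verts R \<Longrightarrow> simple_rep (induce_subgraph Q (V u)) (N u)"
    by metis
  define T where "T u = extend_by_zero Q (V u) (N u)" for u
  have T: "simple_rep Q (T u)" if "u \<in> verts R" for u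
    unfolding T_def using VQ[OF that] N(2)[OF that] by (rule simple_rep_extend_by_zero)
  have dimT: "rep_dim (T u) = restrict_dim (V u) \<alpha>" if "u \<in> verts R" for u
    using N(1)[OF that] by (auto simp: T_def extend_by_zero_def Let_def restrict_dim_def)
  obtain \<phi> where \<phi>: "bij_betw \<phi> {..<card (verts R)} (verts R)"
    using ex_bij_betw_nat_finite[OF R.finite_verts] by (auto simp: atLeast0LessThan)
  define k where "k = card (verts R)"
  define S where "S i = T (\<phi> i)" for i
  have \<phi>R: "\<phi> i \<in> verts R" if "i < k" for i
    using \<phi> that by (auto simp: bij_betw_def k_def)
  have \<phi>inj: "\<phi> i = \<phi> j \<longleftrightarrow> i = j" if "i < k" "j < k" for i j
    using \<phi> that by (auto simp: bij_betw_def k_def inj_on_def)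
  define M where "M = rep_sum (concat (map (\<lambda>i. replicate 1 (S i)) [0..<k]))"
  have Mrep: "is_rep Q M"
    unfolding M_def using T \<phi>R by (intro is_rep_rep_sum) (auto simp: simple_rep_def S_def)
  have Mdim: "rep_dim M x = \<alpha> x" if x: "x \<in> verts Q" for x
  proof -
    obtain u where u: "u \<in> verts R" "x \<in> V u" using cover x by blast
    have "x \<notin> V w" if "w \<in> verts R - {u}" for w
      using disj u that by (auto simp: disjoint_family_on_def)
    then have "(\<Sum>w\<in>verts R - {u}. restrict_dim (V w) \<alpha> x) = 0"
      by (intro sum.neutral) (auto simp: restrict_dim_def)
    then have "(\<Sum>w\<in>verts R. restrict_dim (V w) \<alpha> x) = \<alpha> x"
      using u by (simp add: sum.remove[OF R.finite_verts u(1)] restrict_dim_def)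
    moreover have "rep_dim M x = (\<Sum>i<k. restrict_dim (V (\<phi> i)) \<alpha> x)"
      unfolding M_def rep_dim_rep_sum S_def using dimT \<phi>R by (intro sum.cong) auto
    moreover have "\<dots> = (\<Sum>w\<in>verts R. restrict_dim (V w) \<alpha> x)"
      using sum.reindex_bij_betw[OF \<phi>] by (simp add: k_def)
    ultimately show ?thesis by simp
  qed
  have noniso: "\<not> rep_iso Q (S i) (S j)" if ij: "i < k" "j < k" "i \<noteq> j" for i j
  proof
    assume "rep_iso Q (S i) (S j)"
    moreover obtain x where x: "x \<in> V (\<phi> i)" using ne \<phi>R ij by blast
    moreover have "x \<in> verts Q" using x VQ \<phi>R ij by blast
    moreover have "x \<notin> V (\<phi> j)"
      using x disj \<phi>R[OF ij(1)] \<phi>R[OF ij(2)] \<phi>inj[OF ij(1,2)] ij(3)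
      by (auto simp: disjoint_family_on_def)
    ultimately show False
      using pos[of x] dimT \<phi>R ij by (auto simp: rep_iso_def S_def restrict_dim_def)
  qed
  have form: "int (card (arrows R {u} {w})) =
      (if u = w then 1 else 0) - euler_form Q (rep_dim (T u)) (rep_dim (T w))"
    if uw: "u \<in> verts R" "w \<in> verts R" for u w
  proof (cases "u = w")
    case True
    then show ?thesis
      using loops[OF uw(1)] euler_form_induce_subgraph[OF Q VQ[OF uw(1)]] dimT uw by (simp add: loops_def)
  next
    case False
    have "V u \<inter> V w = {}" using disj uw False by (auto simp: disjoint_family_on_def)
    moreover have "(\<Sum>e\<in>arrows Q (V u) (V w). int (\<alpha> (tail Q e)) * int (\<alpha> (head Q e))) = int (card (arrows Q (V u) (V w)))"
      using dim1[OF uw False] by simp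
    ultimately show ?thesis
      using euler_form_restrict_dim[OF Q VQ[OF uw(1)], of \<alpha> "V w"] arrows[OF uw False] False dimT uw by simp
  qed
  have "rep_iso Q M (rep_sum (concat (map (\<lambda>i. replicate 1 (S i)) [0..<k])))"
    using rep_iso_refl[OF Q Mrep] unfolding M_def .
  then have "semisimple_decomposition Q M k S (\<lambda>_. 1)"
    unfolding semisimple_decomposition_def using Mrep T[OF \<phi>R] noniso by (simp add: S_def)
  moreover have "int (card (arrows R {\<phi> i} {\<phi> j})) =
      (if i = j then 1 else 0) - euler_form Q (rep_dim (S i)) (rep_dim (S j))" if "i < k" "j < k" for i j
    using form[OF \<phi>R \<phi>R, OF that] \<phi>inj[OF that] by (simp add: S_def)
  ultimately show ?thesis
    unfolding local_setting_def using R Mdim \<phi>[folded k_def]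
    by (intro conjI exI[of _ M] exI[of _ k] exI[of _ S] exI[of _ "\<lambda>_. 1"] exI[of _ \<phi>]) blast+
qed

theorem theorem7:
  fixes K :: "'k :: {alg_closed_field, field_char_0} itself"
    and Q :: "('v, 'a) pre_digraph" and \<alpha> :: "'v \<Rightarrow> nat"
    and R :: "('w, 'b) pre_digraph"
  assumes "reduced_setting Q \<alpha>"
    and "sum_of_cycles R"
  shows "local_setting K Q \<alpha> R (\<lambda>_. 1) \<longleftrightarrow>
    (\<exists>V :: 'w \<Rightarrow> 'v set.
       (\<Union>u\<in>verts R. V u) = verts Q \<and>
       disjoint_family_on V (verts R) \<and>
       (\<forall>u\<in>verts R. V u \<noteq> {}) \<and>
       (\<forall>u\<in>verts R.
          simple_setting K (induce_subgraph Q (V u)) \<alpha> \<and>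
          int (card (loops R u)) = 1 - euler_form (induce_subgraph Q (V u)) \<alpha> \<alpha>) \<and>
       (\<forall>u\<in>verts R. \<forall>w\<in>verts R. u \<noteq> w \<longrightarrow>
          card (arrows Q (V u) (V w)) = card (arrows R {u} {w}) \<and>
          (\<forall>e\<in>arrows Q (V u) (V w). \<alpha> (tail Q e) = 1 \<and> \<alpha> (head Q e) = 1)))"
proof -
  have "local_setting K Q \<alpha> R (\<lambda>_. 1) \<longleftrightarrow> (\<exists>V. simple_partition K Q \<alpha> R V)"
  proof
    assume "local_setting K Q \<alpha> R (\<lambda>_. 1)"
    with assms show "\<exists>V. simple_partition K Q \<alpha> R V"
      by (rule partition_of_local_setting)
  next
    assume "\<exists>V. simple_partition K Q \<alpha> R V"
    then obtain V where "simple_partition K Q \<alpha> R V" ..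
    moreover have "quiver_setting Q \<alpha>" using assms(1) by (simp add: reduced_setting_def)
    ultimately show "local_setting K Q \<alpha> R (\<lambda>_. 1)"
      using sum_of_cycles_fin_digraph[OF assms(2)] by (intro local_setting_of_partition)
  qed
  then show ?thesis unfolding simple_partition_def .
qed

end
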